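(* Let $\epsilon,\epsilon'>0$, $n\ge1$, $E\in\mathbb N$, and let $\alpha_1,\dots,\alpha_n$ be samples obtained by measuring with heterodyne detection $n$ copies of a state $\rho=\sum_{k,l=0}^{E}\rho_{kl}\ket k\!\bra l$ (i.e. $\alpha_1,\dots,\alpha_n$ are i.i.d. with density $Q_\rho$). For $k,l\in\mathbb N$ define $$\rho^\epsilon_{kl}=\frac1n\sum_{i=1}^n f_{\ket l\!\bra k}\!\left(\alpha_i,\frac{\epsilon}{K_{\ket l\!\bra k}}\right).$$ Then, with probability greater than $$1-4\sum_{0\le k\le l\le E}\exp\!\left[-\frac{n\,\epsilon^{2+k+l}\epsilon'^2}{4C_{kl}}\right],$$ we have $|\rho_{kl}-\rho^\epsilon_{kl}|\le\epsilon+\epsilon'$ for all $0\le k,l\le E$, where $$C_{kl}=\big[(k+1)(l+1)\big]^{1+\frac{k+l}{2}}\,2^{|l-k|}\binom{\max(k,l)}{\min(k,l)}.$$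
   Context: $\mathcal H$ is the single-mode Hilbert space with Fock basis $\{\ket n\}$; $\ket\alpha$ is a coherent state; $Q_\rho(\alpha)=\frac1\pi\bra\alpha\rho\ket\alpha$ is the density of heterodyne detection outcomes. For $k,l\ge0$, $\mathcal L_{k,l}(z)=\sum_{p=0}^{\min(k,l)}\frac{\sqrt{k!}\sqrt{l!}(-1)^p}{p!(k-p)!(l-p)!}z^{l-p}z^{*(k-p)}$. For an operator $A=\sum_{k,l}A_{kl}\ket k\!\bra l$, $0<\eta<1$ and the fixed cutoff $E$: $f_A(z,\eta)=\frac1\eta e^{(1-\frac1\eta)|z|^2}\sum_{k,l=0}^E A_{kl}\eta^{-(k+l)/2}\mathcal L_{k,l}(z/\sqrt\eta)$ and $K_A=\sum_{k,l=0}^E|A_{kl}|\sqrt{(k+1)(l+1)}$ (so $K_{\ket l\!\bra k}=\sqrt{(k+1)(l+1)}$). *)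

theory Defs
  imports "HOL-Probability.Probability"
begin

text \<open>Operators on the single-mode Fock space with finite support in the Fock
basis are represented by their matrix entries \<open>A k l = <k|A|l>\<close>.\<close>

text \<open>Fock-basis coefficient of the coherent state: \<open><m|alpha> \<close>.\<close>
definition coh :: "complex \<Rightarrow> nat \<Rightarrow> complex" where
  "coh \<alpha> m = of_real (exp (- (cmod \<alpha>)\<^sup>2 / 2) / sqrt (fact m)) * \<alpha> ^ m"

text \<open>Husimi Q function \<open>Q_rho(alpha) = (1/pi) <alpha|rho|alpha>\<close> of
\<open>rho = sum_{k,l<=E} rho_kl |k><l|\<close> (real, as rho is Hermitian).\<close>
definition Qfun :: "nat \<Rightarrow> (nat \<Rightarrow> nat \<Rightarrow> complex) \<Rightarrow> complex \<Rightarrow> real" where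
  "Qfun E \<rho> \<alpha> = Re (\<Sum>k\<le>E. \<Sum>l\<le>E. cnj (coh \<alpha> k) * \<rho> k l * coh \<alpha> l) / pi"

definition is_state :: "nat \<Rightarrow> (nat \<Rightarrow> nat \<Rightarrow> complex) \<Rightarrow> bool" where
  "is_state E \<rho> \<longleftrightarrow>
     (\<forall>v :: nat \<Rightarrow> complex.
        Im (\<Sum>k\<le>E. \<Sum>l\<le>E. cnj (v k) * \<rho> k l * v l) = 0 \<and>
        Re (\<Sum>k\<le>E. \<Sum>l\<le>E. cnj (v k) * \<rho> k l * v l) \<ge> 0)
     \<and> (\<Sum>k\<le>E. \<rho> k k) = 1"

definition ketbra :: "nat \<Rightarrow> nat \<Rightarrow> (nat \<Rightarrow> nat \<Rightarrow> complex)" where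
  "ketbra l k = (\<lambda>a b. if a = l \<and> b = k then 1 else 0)"

definition LL :: "nat \<Rightarrow> nat \<Rightarrow> complex \<Rightarrow> complex" where
  "LL k l z = (\<Sum>p\<le>min k l.
      of_real (sqrt (fact k) * sqrt (fact l) * (-1) ^ p / (fact p * fact (k - p) * fact (l - p)))
      * z ^ (l - p) * cnj z ^ (k - p))"

definition fA :: "nat \<Rightarrow> (nat \<Rightarrow> nat \<Rightarrow> complex) \<Rightarrow> complex \<Rightarrow> real \<Rightarrow> complex" where
  "fA E A z \<eta> = of_real (1 / \<eta> * exp ((1 - 1 / \<eta>) * (cmod z)\<^sup>2)) *
     (\<Sum>k\<le>E. \<Sum>l\<le>E. A k l * of_real (\<eta> powr (- (real k + real l) / 2))
                        * LL k l (z / of_real (sqrt \<eta>)))"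

definition KA :: "nat \<Rightarrow> (nat \<Rightarrow> nat \<Rightarrow> complex) \<Rightarrow> real" where
  "KA E A = (\<Sum>k\<le>E. \<Sum>l\<le>E. cmod (A k l) * sqrt (real ((k + 1) * (l + 1))))"

definition rho_est :: "nat \<Rightarrow> nat \<Rightarrow> real \<Rightarrow> nat \<Rightarrow> nat \<Rightarrow> (nat \<Rightarrow> complex) \<Rightarrow> complex" where
  "rho_est E n \<epsilon> k l \<alpha> =
     (\<Sum>i<n. fA E (ketbra l k) (\<alpha> i) (\<epsilon> / KA E (ketbra l k))) / of_nat n"

definition Ckl :: "nat \<Rightarrow> nat \<Rightarrow> real" where
  "Ckl k l = real ((k + 1) * (l + 1)) powr (1 + (real k + real l) / 2)
             * 2 ^ (max k l - min k l) * real (max k l choose min k l)"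

definition sample_measure :: "nat \<Rightarrow> (nat \<Rightarrow> nat \<Rightarrow> complex) \<Rightarrow> nat \<Rightarrow> (nat \<Rightarrow> complex) measure" where
  "sample_measure E \<rho> n = PiM {..<n} (\<lambda>_. density lborel (\<lambda>z. ennreal (Qfun E \<rho> z)))"

end

theory Submission
  imports Defs
begin

text \<open>
  Write \<open>H\<^sub>k\<^sub>l\<close> for the complex Hermite (Ito) polynomials, so that \<open>LL k l = H\<^sub>k\<^sub>l / sqrt (k! l!)\<close>.

  Bias: by the Gaussian moments in the plane, the expectation of \<open>f\<close> for \<open>|l><k|\<close> under the
  heterodyne density is \<open>\<Sum>\<^sub>m \<rho> (k+m) (l+m) \<eta>^m sqrt (C(k+m,m) C(l+m,m))\<close>. Since
  \<open>C(k+m,m) \<le> (k+1)^m\<close>, the coefficient is at most \<open>(\<eta> K)^m = \<epsilon>^m\<close>, and positivity together with unit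
  trace bounds the sum of the terms with \<open>m \<ge> 1\<close> by \<open>\<epsilon>\<close>.

  Concentration: \<open>exp (-|w|^2/2) LL k l w\<close> is a matrix entry of a displacement operator, hence has
  modulus at most 1. This bounds \<open>f\<close> when \<open>\<eta> \<le> 1/2\<close>, which can fail only for \<open>k = 0\<close> or \<open>l = 0\<close>, where
  \<open>LL k l\<close> is a monomial and a direct estimate suffices. Hoeffding's inequality is applied to the real
  and the imaginary part at level \<open>\<epsilon>'/sqrt 2\<close>. The events for \<open>(k,l)\<close> and \<open>(l,k)\<close> coincide, and the
  final bound is strict because \<open>f\<close> is real for \<open>k = l\<close>, which saves a factor 2 there.
\<close>

section \<open>Complex Hermite polynomials\<close>

text \<open>The recursion applies \<open>cnj z - d/dz\<close>, since lowering \<open>l\<close> with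
  factor \<open>l\<close> is the \<open>z\<close>-derivative. It trades a step in \<open>k\<close>
  for one factor \<open>cnj z\<close> and one lowered index, which is what makes the later moment
  induction possible. At \<open>l = 0\<close> the factor \<open>of_nat l\<close> disarms the
  truncated \<open>l - 1\<close>.\<close>

fun ito_hermite :: "nat \<Rightarrow> nat \<Rightarrow> complex \<Rightarrow> complex" where
  "ito_hermite 0 l z = z ^ l"
| "ito_hermite (Suc k) l z = cnj z * ito_hermite k l z - of_nat l * ito_hermite k (l - 1) z"

text \<open>Induction on \<open>k\<close>: the coefficient with index \<open>p + 1\<close> obeys
  Pascal's rule in \<open>k\<close>, once an absorption identity has shifted the binomial in
  \<open>l\<close>. Indices \<open>p > l\<close> do no harm because \<open>l choose p\<close> is
  zero there.\<close>

lemma ito_hermite_eq_sum: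
  "ito_hermite k l z =
     (\<Sum>p\<le>k. (-1) ^ p * of_nat (fact p * (k choose p) * (l choose p)) * z ^ (l - p) * cnj z ^ (k - p))"
proof (induction k arbitrary: l)
  case 0
  then show ?case by simp
next
  case (Suc k)
  define t where "t n m p = (-1) ^ p * of_nat (fact p * (n choose p) * (m choose p)) * z ^ (m - p)
      * cnj z ^ (n - p)"
    for n m p :: nat
  have step: "t (Suc k) l (Suc p) = cnj z * t k l (Suc p) - of_nat l * t k (l - 1) p" if "p \<le> k" for p
  proof -
    \<comment> \<open>Absorption identity; for \<open>l = 0\<close> both sides are zero.\<close>
    have l: "(Suc p) * (l choose Suc p) = l * ((l - 1) choose p)"
      by (cases l) (simp_all only: Suc_times_binomial_eq diff_Suc_1, simp_all add: mult.commute)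
    have "cnj z * t k l (Suc p) =
        (-1) ^ Suc p * of_nat (fact (Suc p) * (k choose Suc p) * (l choose Suc p)) * z ^ (l - Suc p)
            * cnj z ^ (k - p)"
    \<comment> \<open>For \<open>p = k\<close> the exponent \<open>k - Suc p\<close> is truncated,
      so the powers of \<open>cnj z\<close> do not match, but
      \<open>k choose Suc k = 0\<close>.\<close>
    proof (cases "p = k")
      case True
      then show ?thesis by (simp add: t_def)
    next
      case False
      then have "k - p = Suc (k - Suc p)" using that by simp
      then show ?thesis by (simp add: t_def)
    qed
    moreover have "of_nat l * t k (l - 1) p =
        (-1) ^ p * of_nat (fact (Suc p) * (k choose p) * (l choose Suc p)) * z ^ (l - Suc p)
            * cnj z ^ (k - p)"
    proof -
      have "l * (fact p * (k choose p) * ((l - 1) choose p))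
          = fact p * (k choose p) * (Suc p * (l choose Suc p))"
        by (subst l) simp
      also have "\<dots> = fact (Suc p) * (k choose p) * (l choose Suc p)"
        by (simp add: algebra_simps)
      finally have e: "l * (fact p * (k choose p) * ((l - 1) choose p))
          = fact (Suc p) * (k choose p) * (l choose Suc p)" .
      show ?thesis
        unfolding t_def e[symmetric] by (simp add: algebra_simps)
    qed
    ultimately show ?thesis
      by (simp add: t_def algebra_simps)
  qed
  have "(\<Sum>p\<le>Suc k. t (Suc k) l p) = t (Suc k) l 0 + (\<Sum>p\<le>k. t (Suc k) l (Suc p))"
    by (rule sum.atMost_Suc_shift)
  also have "(\<Sum>p\<le>k. t (Suc k) l (Suc p)) = cnj z * (\<Sum>p\<le>k. t k l (Suc p)) - of_nat l * (\<Sum>p\<le>k. t k (l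
      - 1) p)"
    by (simp add: step sum_subtractf sum_distrib_left)
  also have "t (Suc k) l 0 = cnj z * t k l 0"
    by (simp add: t_def)
  also have "cnj z * t k l 0 + (cnj z * (\<Sum>p\<le>k. t k l (Suc p)) - of_nat l * (\<Sum>p\<le>k. t k (l - 1) p))
      = cnj z * (\<Sum>p\<le>Suc k. t k l p) - of_nat l * (\<Sum>p\<le>k. t k (l - 1) p)"
    unfolding sum.atMost_Suc_shift by (simp add: algebra_simps)
  also have "(\<Sum>p\<le>Suc k. t k l p) = (\<Sum>p\<le>k. t k l p)"
    by (simp add: t_def)
  finally show ?case
    using Suc by (simp add: t_def)
qed

lemma LL_eq_ito_hermite:
  "LL k l z = ito_hermite k l z / of_real (sqrt (fact k) * sqrt (fact l))"
proof -
  have c: "sqrt (fact k) * sqrt (fact l) * (-1) ^ p / (fact p * fact (k - p) * fact (l - p))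
      = (-1) ^ p * real (fact p * (k choose p) * (l choose p)) / (sqrt (fact k) * sqrt (fact l))"
    if "p \<le> min k l" for p
  proof -
    have k: "real (k choose p) = fact k / (fact p * fact (k - p))"
      and l: "real (l choose p) = fact l / (fact p * fact (l - p))"
      using that by (simp_all add: binomial_fact)
    have "sqrt (fact k) * sqrt (fact k) = (fact k :: real)" "sqrt (fact l) * sqrt (fact l)
        = (fact l :: real)"
      by simp_all
    then show ?thesis
      unfolding of_nat_mult k l of_nat_fact
      by (simp add: field_simps)
  qed
  have "ito_hermite k l z =
     (\<Sum>p\<le>min k l. (-1) ^ p * of_nat (fact p * (k choose p) * (l choose p)) * z ^ (l - p) * cnj z ^ (k
         - p))"
    unfolding ito_hermite_eq_sum by (rule sum.mono_neutral_right) auto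
  moreover have "LL k l z = (\<Sum>p\<le>min k l. of_real ((-1) ^ p * real (fact p * (k choose p)
      * (l choose p)) / (sqrt (fact k) * sqrt (fact l)))
      * z ^ (l - p) * cnj z ^ (k - p))"
    unfolding LL_def using c by (intro sum.cong) auto
  ultimately show ?thesis
    by (simp add: sum_divide_distrib)
qed

section \<open>Symmetry, ladder relations and a uniform bound for the normalised polynomials\<close>

lemma cnj_LL: "cnj (LL k l z) = LL l k z"
  by (simp add: LL_def min.commute mult_ac)

text \<open>Up to signs and normalisation this is the commutation of a displacement operator with a
  ladder operator, read entry by entry. At \<open>l = 0\<close> the factor \<open>sqrt 0\<close>
  removes the truncated index.\<close>

lemma LL_Suc_left:
  "of_real (sqrt (real (Suc k))) * LL (Suc k) l z
      = cnj z * LL k l z - of_real (sqrt (real l)) * LL k (l - 1) z"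
proof -
  have s: "sqrt (fact (Suc n)) = sqrt (real (Suc n)) * sqrt (fact n)" for n
    by (simp only: fact_Suc real_sqrt_mult)
  have l: "complex_of_real (sqrt (real l)) * (ito_hermite k (l - 1) z / of_real (sqrt (fact k)
      * sqrt (fact (l - 1))))
     = of_nat l * ito_hermite k (l - 1) z / of_real (sqrt (fact k) * sqrt (fact l))"
  proof (cases l)
    case (Suc m)
    have "complex_of_real (sqrt (real l)) * complex_of_real (sqrt (real l)) = of_nat l"
      by (simp flip: of_real_mult)
    then show ?thesis
      using s[of m] Suc
      by (simp add: divide_simps del: of_nat_Suc fact_Suc)
  qed simp
  show ?thesis
    unfolding LL_eq_ito_hermite l
    using s[of k] by (simp add: field_simps del: of_nat_Suc fact_Suc)
qed

lemma LL_Suc_right: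
  "of_real (sqrt (real (Suc l))) * LL k (Suc l) z
      = z * LL k l z - of_real (sqrt (real k)) * LL (k - 1) l z"
  using arg_cong[OF LL_Suc_left[of l k z], of cnj] by (simp add: cnj_LL del: of_nat_Suc)

text \<open>Multiply by \<open>sqrt (k + 1)\<close>, apply \<open>LL_Suc_left\<close> to one factor
  of each square, and move the shifted sum back with the conjugate of \<open>LL_Suc_right\<close>.
  The mixed products cancel for all \<open>l < N\<close>, so only the boundary product at
  \<open>l = N\<close> survives.\<close>

lemma sum_LL_recurrence:
  "complex_of_real (\<Sum>l\<le>N. (cmod (LL (Suc k) l z))\<^sup>2) =
     of_real (\<Sum>l<N. (cmod (LL k l z))\<^sup>2) +
     cnj z * LL k N z * cnj (LL (Suc k) N z) / of_real (sqrt (real (Suc k)))"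
proof -
  let ?s = "complex_of_real (sqrt (real (Suc k)))"
  have shift: "(\<Sum>l\<le>N. of_real (sqrt (real l)) * LL k (l - 1) z * cnj (LL (Suc k) l z))
      = (\<Sum>l<N. LL k l z * (cnj z * cnj (LL (Suc k) l z) - ?s * cnj (LL k l z)))"
  proof -
    have "(\<Sum>l\<le>N. of_real (sqrt (real l)) * LL k (l - 1) z * cnj (LL (Suc k) l z))
        = (\<Sum>l<N. of_real (sqrt (real (Suc l))) * LL k l z * cnj (LL (Suc k) (Suc l) z))"
      by (subst sum.atMost_shift) simp
    also have "\<dots> = (\<Sum>l<N. LL k l z * (cnj z * cnj (LL (Suc k) l z) - ?s * cnj (LL k l z)))"
      using arg_cong[OF LL_Suc_right[of _ "Suc k" z], of cnj]
      by (intro sum.cong) (simp_all add: mult_ac del: of_nat_Suc)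
    finally show ?thesis .
  qed
  have "?s * of_real (\<Sum>l\<le>N. (cmod (LL (Suc k) l z))\<^sup>2) =
      (\<Sum>l\<le>N. (?s * LL (Suc k) l z) * cnj (LL (Suc k) l z))"
    by (simp add: sum_distrib_left complex_norm_square mult_ac del: of_nat_Suc of_real_power)
  also have "\<dots> = (\<Sum>l\<le>N. cnj z * LL k l z * cnj (LL (Suc k) l z))
      - (\<Sum>l\<le>N. of_real (sqrt (real l)) * LL k (l - 1) z * cnj (LL (Suc k) l z))"
    unfolding LL_Suc_left by (simp add: algebra_simps sum_subtractf)
  also have "\<dots> = ?s * (\<Sum>l<N. LL k l z * cnj (LL k l z)) + cnj z * LL k N z * cnj (LL (Suc k) N z)"
    unfolding shift unfolding lessThan_Suc_atMost[symmetric]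
    by (simp add: algebra_simps sum_subtractf sum_distrib_left)
  also have "(\<Sum>l<N. LL k l z * cnj (LL k l z)) = of_real (\<Sum>l<N. (cmod (LL k l z))\<^sup>2)"
    by (simp add: complex_norm_square del: of_real_power)
  finally show ?thesis
    by (simp add: field_simps del: of_nat_Suc)
qed

text \<open>
  This is the norm of a column of a unitary operator, bounded by induction on \<open>k\<close>: the boundary
  term of the preceding recurrence vanishes as \<open>N\<close> grows, because the previous column is square summable.
\<close>

lemma sum_LL_le_exp:
  "(\<Sum>l\<le>N. (cmod (LL k l z))\<^sup>2) \<le> exp ((cmod z)\<^sup>2)"
proof (induction k arbitrary: N)
  case 0
  have "(cmod (LL 0 l z))\<^sup>2 = ((cmod z)\<^sup>2) ^ l / fact l" for l
    by (simp add: LL_eq_ito_hermite norm_divide norm_power power_divide norm_mult flip: power_mult)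
       (simp add: mult.commute)
  moreover have "(\<Sum>l\<le>N. ((cmod z)\<^sup>2) ^ l / fact l) \<le> exp ((cmod z)\<^sup>2)"
    unfolding exp_def
    using sum_le_suminf[OF summable_exp_generic[of "(cmod z)\<^sup>2"], of "{..N}"]
    by (simp add: divide_inverse mult.commute)
  ultimately show ?case by simp
next
  case (Suc k)
  define T where "T = (\<lambda>N. \<Sum>l\<le>N. (cmod (LL (Suc k) l z))\<^sup>2)"
  define b where "b = (\<lambda>N. cmod z * cmod (LL k N z) / sqrt (real (Suc k)))"
  let ?A = "exp ((cmod z)\<^sup>2)"
  have "summable (\<lambda>l. (cmod (LL k l z))\<^sup>2)"
    using Suc.IH by (intro bounded_imp_summable) auto
  then have "(\<lambda>l. (cmod (LL k l z))\<^sup>2) \<longlonglongrightarrow> 0"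
    by (rule summable_LIMSEQ_zero)
  then have "(\<lambda>l. sqrt ((cmod (LL k l z))\<^sup>2)) \<longlonglongrightarrow> sqrt 0"
    by (rule tendsto_real_sqrt)
  then have b0: "b \<longlonglongrightarrow> 0"
    unfolding b_def by (auto intro!: tendsto_eq_intros simp: tendsto_norm_zero_iff)
  \<comment> \<open>A self-bounding inequality: the last entry of the column is itself at most
    \<open>sqrt (T N)\<close>.\<close>
  have T_le: "T N \<le> ?A + b N * sqrt (T N)" for N
  proof -
    have "0 \<le> T N"
      by (simp add: T_def sum_nonneg)
    then have "T N = cmod (complex_of_real (T N))"
      by simp
    also have "\<dots> \<le> (\<Sum>l<N. (cmod (LL k l z))\<^sup>2) + b N * cmod (LL (Suc k) N z)"
      unfolding T_def sum_LL_recurrence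
      by (rule order_trans[OF norm_triangle_ineq])
         (simp add: b_def norm_mult norm_divide sum_nonneg del: of_nat_Suc of_real_sum)
    also have "(\<Sum>l<N. (cmod (LL k l z))\<^sup>2) \<le> ?A"
      by (rule order_trans[OF sum_mono2 Suc.IH[of N]]) auto
    also have "b N * cmod (LL (Suc k) N z) \<le> b N * sqrt (T N)"
    proof (rule mult_left_mono)
      show "cmod (LL (Suc k) N z) \<le> sqrt (T N)"
        unfolding T_def by (rule real_le_rsqrt) (rule member_le_sum, auto)
    qed (simp add: b_def)
    finally show ?thesis by simp
  qed
  have lim: "(\<lambda>N. ?A / (1 - b N)) \<longlonglongrightarrow> ?A / (1 - 0)"
    by (intro tendsto_intros b0) auto
  \<comment> \<open>Here \<open>N\<close> is fixed and \<open>M\<close> grows: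
    \<open>T N \<le> T M\<close> by monotonicity, and the inequality at \<open>M\<close> can be
    solved for \<open>T M\<close> as soon as \<open>b M < 1\<close>.\<close>
  have "\<forall>\<^sub>F M in sequentially. T N \<le> ?A / (1 - b M)"
  proof -
    have "\<forall>\<^sub>F M in sequentially. b M < 1"
      using order_tendstoD(2)[OF b0, of 1] by simp
    then show ?thesis
      using eventually_ge_at_top[of N]
    proof eventually_elim
      case (elim M)
      have "0 \<le> b M" by (simp add: b_def)
      have mono: "T N \<le> T M"
        unfolding T_def by (rule sum_mono2) (use elim in auto)
      show ?case
      \<comment> \<open>Replacing \<open>sqrt (T M)\<close> by \<open>T M\<close> requires
        \<open>T M\<close> to be at least 1; otherwise \<open>1 \<le> ?A\<close> already
        suffices.\<close>
      proof (cases "T M \<le> 1")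
        case True
        have "1 \<le> ?A" by simp
        also have "?A \<le> ?A / (1 - b M)"
          using elim \<open>0 \<le> b M\<close> by (simp add: field_simps)
        finally show ?thesis using mono True by linarith
      next
        case False
        then have "sqrt (T M) \<le> T M"
          by (simp add: sqrt_le_D real_le_lsqrt self_le_power)
        then have "T M \<le> ?A + b M * T M"
          using T_le[of M] \<open>0 \<le> b M\<close> by (smt (verit) mult_left_mono)
        then have "T M \<le> ?A / (1 - b M)"
          using elim by (simp add: field_simps)
        then show ?thesis using mono by linarith
      qed
    qed
  qed
  then have "T N \<le> ?A / (1 - 0)"
    by (intro tendsto_lowerbound[OF lim]) auto
  then show ?case by (simp add: T_def)
qed

lemma cmod_LL_le_exp: "cmod (LL k l z) \<le> exp ((cmod z)\<^sup>2 / 2)"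
proof -
  have "(cmod (LL k l z))\<^sup>2 \<le> (\<Sum>l\<le>l. (cmod (LL k l z))\<^sup>2)"
    by (rule member_le_sum) auto
  also have "\<dots> \<le> exp ((cmod z)\<^sup>2)"
    by (rule sum_LL_le_exp)
  also have "\<dots> = (exp ((cmod z)\<^sup>2 / 2))\<^sup>2"
    by (simp flip: exp_double)
  finally show ?thesis
    by (rule power2_le_imp_le) simp
qed

section \<open>Gaussian moments in the complex plane\<close>

lemma measurable_Complex [measurable]:
  "(\<lambda>(x, y). Complex x y) \<in> borel_measurable (lborel \<Otimes>\<^sub>M lborel)"
  unfolding borel_measurable_complex_iff by (simp add: split_beta')

text \<open>Lebesgue measure is determined by the volumes of boxes, and the preimage of a box in the
  plane is a product of two intervals.\<close>

lemma lborel_complex_eq_distr: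
  "(lborel :: complex measure) = distr (lborel \<Otimes>\<^sub>M lborel) borel (\<lambda>(x, y). Complex x y)"
proof (rule lborel_eqI)
  fix l u :: complex
  assume "\<And>b. b \<in> Basis \<Longrightarrow> l \<bullet> b \<le> u \<bullet> b"
  then have le: "Re l \<le> Re u" "Im l \<le> Im u"
    by (force simp: Basis_complex_def inner_complex_def)+
  have "(\<lambda>(x, y). Complex x y) -` box l u \<inter> space (lborel \<Otimes>\<^sub>M lborel) = {Re l<..<Re u} \<times> {Im l<..<Im u}"
    by (auto simp: in_box_complex_iff space_pair_measure)
  then show "emeasure (distr (lborel \<Otimes>\<^sub>M lborel) borel (\<lambda>(x, y). Complex x y)) (box l u)
      = ennreal (\<Prod>b\<in>Basis. (u - l) \<bullet> b)"
    using le by (simp add: emeasure_distr lborel.emeasure_pair_measure_Times Basis_complex_def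
        inner_complex_def ennreal_mult)
qed simp

text \<open>Fubini in both orders: an \<open>x\<close>-derivative has to be integrated in
  \<open>x\<close> first, a \<open>y\<close>-derivative in \<open>y\<close> first.\<close>

lemma
  fixes g :: "complex \<Rightarrow> complex"
  assumes "integrable lborel g"
  shows integral_complex_Re_Im: "integral\<^sup>L lborel g = (LBINT x. LBINT y. g (Complex x y))"
    and integral_complex_Im_Re: "integral\<^sup>L lborel g = (LBINT y. LBINT x. g (Complex x y))"
proof -
  have [measurable]: "g \<in> borel_measurable borel"
    using borel_measurable_integrable[OF assms] by simp
  have g': "integrable (distr (lborel \<Otimes>\<^sub>M lborel) borel (\<lambda>(x, y). Complex x y)) g"
    using assms by (simp flip: lborel_complex_eq_distr)
  have i: "integrable (lborel \<Otimes>\<^sub>M lborel) (\<lambda>(x, y). g (Complex x y))"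
    using g' by (subst (asm) integrable_distr_eq) (auto simp: split_beta')
  have e: "integral\<^sup>L lborel g = (LINT (x, y)|(lborel \<Otimes>\<^sub>M lborel). g (Complex x y))"
    by (subst lborel_complex_eq_distr, subst integral_distr) (auto simp: split_beta')
  show "integral\<^sup>L lborel g = (LBINT x. LBINT y. g (Complex x y))"
    unfolding e using lborel_pair.integral_fst[OF i] by simp
  show "integral\<^sup>L lborel g = (LBINT y. LBINT x. g (Complex x y))"
    unfolding e using lborel_pair.integral_snd[OF i] by simp
qed

text \<open>The fundamental theorem on the whole line. If \<open>f\<close> is not integrable, its
  Bochner integral is 0 by convention, so integrability along individual lines never has to be
  checked.\<close>

lemma integral_derivative_eq_0:
  fixes F f :: "real \<Rightarrow> complex"
  assumes "\<And>x. (F has_vector_derivative f x) (at x)" and "continuous_on UNIV f"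
    and "(F \<longlongrightarrow> 0) at_top" and "(F \<longlongrightarrow> 0) at_bot"
  shows "integral\<^sup>L lborel f = 0"
proof (cases "integrable lborel f")
  case True
  have "(LBINT x=-\<infinity>..\<infinity>. f x) = 0 - 0"
    using assms True
    by (intro interval_integral_FTC_integrable[where F = F])
       (auto simp: ereal_tendsto_simps set_integrable_def continuous_on_eq_continuous_at)
  then show ?thesis
    by (simp add: interval_integral_to_infinity_eq interval_lebesgue_integral_def
        set_lebesgue_integral_def)
qed (simp add: not_integrable_integral_eq)

lemma gaussian_integral_complex:
  assumes "c > 0"
  shows "has_bochner_integral lborel (\<lambda>z::complex. exp (- c * (cmod z)\<^sup>2)) (pi / c)"
proof -
  \<comment> \<open>This variance makes the product of two normal densities equal to
    \<open>c / pi\<close> times the Gaussian, so the normalisation of the normal density gives the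
    value.\<close>
  define \<sigma> where "\<sigma> = sqrt (1 / (2 * c))"
  have \<sigma>: "\<sigma> > 0" "\<sigma>\<^sup>2 = 1 / (2 * c)"
    using assms by (simp_all add: \<sigma>_def)
  let ?N = "normal_density 0 \<sigma>"
  have one: "(\<integral>\<^sup>+x. ennreal (?N x) \<partial>lborel) = 1"
    using \<sigma> by (subst nn_integral_eq_integral) auto
  have split: "exp (- c * (cmod (Complex x y))\<^sup>2) = pi / c * (?N x * ?N y)" for x y
  proof -
    have "?N x * ?N y = (1 / sqrt (pi / c) * 1 / sqrt (pi / c)) * (exp (- c * x\<^sup>2) * exp (- c * y\<^sup>2))"
      unfolding normal_density_def \<sigma>(2) using assms by (simp add: mult.commute)
    also have "1 / sqrt (pi / c) * 1 / sqrt (pi / c) = c / pi"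
      using assms by (simp add: real_sqrt_divide)
    also have "exp (- c * x\<^sup>2) * exp (- c * y\<^sup>2) = exp (- c * (cmod (Complex x y))\<^sup>2)"
      by (simp add: cmod_power2 algebra_simps flip: exp_add)
    finally show ?thesis using assms by simp
  qed
  have "(\<integral>\<^sup>+z. ennreal (exp (- c * (cmod z)\<^sup>2)) \<partial>lborel)
      = (\<integral>\<^sup>+p. (case p of (x, y) \<Rightarrow> ennreal (pi / c * (?N x * ?N y))) \<partial>(lborel \<Otimes>\<^sub>M lborel))"
    by (subst lborel_complex_eq_distr, subst nn_integral_distr) (simp_all only: split split_beta',
        simp_all)
  also have "\<dots> = (\<integral>\<^sup>+x. \<integral>\<^sup>+y. ennreal (pi / c) * ennreal (?N x) * ennreal (?N y) \<partial>lborel \<partial>lborel)"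
    using assms by (subst lborel.nn_integral_fst[symmetric])
      (simp_all add: mult.assoc flip: ennreal_mult')
  also have "\<dots> = ennreal (pi / c)"
    by (simp add: nn_integral_cmult one nn_integral_multc mult.assoc)
  finally show ?thesis
    using assms by (intro has_bochner_integral_nn_integral) auto
qed

section \<open>Decay and integrability of Gaussian monomials\<close>

lemma power_div_fact_le_exp:
  fixes y :: real
  assumes "y \<ge> 0"
  shows "y ^ n / fact n \<le> exp y"
  using sum_le_suminf[OF summable_exp_generic[of y], of "{n}"] assms
  by (simp add: exp_def divide_inverse mult.commute)

lemma power_le_const_exp:
  fixes c :: real
  assumes "c > 0"
  obtains C where "C \<ge> 0" "\<And>r. r \<ge> 0 \<Longrightarrow> r ^ n \<le> C * exp (c * r\<^sup>2)"
proof
  show "1 + fact n / c ^ n \<ge> 0" using assms by simp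
  fix r :: real assume r: "r \<ge> 0"
  have "(c * r\<^sup>2) ^ n \<le> fact n * exp (c * r\<^sup>2)"
    using power_div_fact_le_exp[of "c * r\<^sup>2" n] assms by (simp add: pos_divide_le_eq mult.commute)
  then have "(r\<^sup>2) ^ n \<le> fact n / c ^ n * exp (c * r\<^sup>2)"
    using assms by (simp add: pos_le_divide_eq power_mult_distrib mult.commute)
  \<comment> \<open>Passing to the even power \<open>2 * n\<close> lets one term of the exponential
    series in \<open>c * r\<^sup>2\<close> serve every \<open>n\<close>, without a split by
    parity.\<close>
  moreover have "r ^ n \<le> 1 + (r\<^sup>2) ^ n"
  proof (cases "r \<le> 1")
    case True
    then have "r ^ n \<le> 1" using r by (intro power_le_one)
    then show ?thesis by (rule order_trans) simp
  next
    case False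
    then have "r ^ n \<le> (r\<^sup>2) ^ n"
      by (intro power_mono) (auto simp: power2_eq_square)
    then show ?thesis by simp
  qed
  moreover have "1 \<le> exp (c * r\<^sup>2)" using assms by simp
  ultimately show "r ^ n \<le> (1 + fact n / c ^ n) * exp (c * r\<^sup>2)"
    unfolding distrib_right mult_1 by linarith
qed

definition gauss_monomial :: "real \<Rightarrow> nat \<Rightarrow> nat \<Rightarrow> complex \<Rightarrow> complex" where
  "gauss_monomial c a b z = z ^ a * cnj z ^ b * of_real (exp (- c * (cmod z)\<^sup>2))"

lemma gauss_monomial_bound:
  assumes "c > 0"
  obtains C where "\<And>z. cmod (gauss_monomial c a b z) \<le> C * exp (- (c / 2) * (cmod z)\<^sup>2)" "C \<ge> 0"
proof -
  \<comment> \<open>Half of the Gaussian decay is spent on absorbing the polynomial factor; the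
    other half remains.\<close>
  obtain C where C: "C \<ge> 0" "\<And>r. r \<ge> 0 \<Longrightarrow> r ^ (a + b) \<le> C * exp (c / 2 * r\<^sup>2)"
    by (rule power_le_const_exp[OF half_gt_zero[OF assms], of "a + b"]) (rule that)
  have "cmod (gauss_monomial c a b z) \<le> C * exp (- (c / 2) * (cmod z)\<^sup>2)" for z
  proof -
    have "cmod (gauss_monomial c a b z) = cmod z ^ (a + b) * exp (- c * (cmod z)\<^sup>2)"
      by (simp add: gauss_monomial_def norm_mult norm_power power_add)
    also have "\<dots> \<le> C * exp (c / 2 * (cmod z)\<^sup>2) * exp (- c * (cmod z)\<^sup>2)"
      by (intro mult_right_mono C) auto
    also have "\<dots> = C * exp (- (c / 2) * (cmod z)\<^sup>2)"
      by (simp flip: exp_add)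
    finally show ?thesis .
  qed
  then show thesis by (rule that) (rule C(1))
qed

lemma measurable_gauss_monomial [measurable]: "gauss_monomial c a b \<in> borel_measurable borel"
  unfolding gauss_monomial_def by (intro borel_measurable_continuous_onI continuous_intros)

lemma integrable_gauss_monomial:
  assumes "c > 0"
  shows "integrable lborel (gauss_monomial c a b)"
proof -
  obtain C where C: "\<And>z. cmod (gauss_monomial c a b z) \<le> C * exp (- (c / 2) * (cmod z)\<^sup>2)" "C \<ge> 0"
    by (rule gauss_monomial_bound[OF assms, of a b]) (rule that)
  have "integrable lborel (\<lambda>z::complex. C * exp (- (c / 2) * (cmod z)\<^sup>2))"
    using gaussian_integral_complex[of "c / 2"] assms
    by (intro integrable_mult_right) (auto simp: has_bochner_integral_iff)
  then show ?thesis
    by (rule Bochner_Integration.integrable_bound) (use C in auto)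
qed

text \<open>This disposes of the boundary terms when integrating by parts; \<open>h\<close> will run
  along a horizontal or vertical line towards either end.\<close>

lemma gauss_monomial_tendsto_0:
  assumes "c > 0" and "filterlim h at_infinity G"
  shows "((\<lambda>x. gauss_monomial c a b (h x)) \<longlongrightarrow> 0) G"
proof -
  obtain C where C: "\<And>z. cmod (gauss_monomial c a b z) \<le> C * exp (- (c / 2) * (cmod z)\<^sup>2)"
    by (rule gauss_monomial_bound[OF assms(1), of a b]) (rule that)
  have "((\<lambda>r. C * exp (- (c / 2) * r\<^sup>2)) \<longlongrightarrow> 0) at_top"
    using assms(1) by real_asymp
  then have "((\<lambda>x. C * exp (- (c / 2) * (cmod (h x))\<^sup>2)) \<longlongrightarrow> 0) G"
    by (rule filterlim_compose) (use assms(2) in \<open>simp add: filterlim_at_infinity_conv_norm_at_top\<close>)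
  then show ?thesis
    by (rule Lim_null_comparison[rotated]) (use C in auto)
qed

lemma filterlim_Complex_at_infinity:
  "filterlim (\<lambda>x. Complex x y) at_infinity at_top" "filterlim (\<lambda>x. Complex x y) at_infinity at_bot"
  "filterlim (\<lambda>y. Complex x y) at_infinity at_top" "filterlim (\<lambda>y. Complex x y) at_infinity at_bot"
proof -
  have "filterlim (\<lambda>t::real. \<bar>t\<bar>) at_top at_top" "filterlim (\<lambda>t::real. \<bar>t\<bar>) at_top at_bot"
    by (simp_all add: filterlim_abs_real) real_asymp
  moreover have "\<bar>x\<bar> \<le> cmod (Complex x y)" "\<bar>y\<bar> \<le> cmod (Complex x y)" for x y
    using abs_Re_le_cmod[of "Complex x y"] abs_Im_le_cmod[of "Complex x y"] by simp_all
  ultimately show "filterlim (\<lambda>x. Complex x y) at_infinity at_top" "filterlim (\<lambda>x. Complex x y)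
      at_infinity at_bot"
    "filterlim (\<lambda>y. Complex x y) at_infinity at_top" "filterlim (\<lambda>y. Complex x y) at_infinity at_bot"
    unfolding filterlim_at_infinity_conv_norm_at_top
    by (auto elim!: filterlim_at_top_mono intro!: always_eventually)
qed

text \<open>Integration by parts in the Wirtinger sense: the derivative in \<open>cnj z\<close> of
  the monomial with exponents \<open>a\<close> and \<open>b\<close> integrates to zero. It lowers
  \<open>b\<close> in one term, while the Gaussian contributes \<open>- c * z\<close> in the other.
  \<open>gx\<close> and \<open>gy\<close> are the real partial derivatives.\<close>

lemma gauss_monomial_moment_step:
  assumes c: "c > 0"
  shows "integral\<^sup>L lborel (gauss_monomial c (Suc a) b)
      = of_real (1 / c) * of_nat b * integral\<^sup>L lborel (gauss_monomial c a (b - 1))"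
proof -
  define gx where "gx z = of_nat a * gauss_monomial c (a - 1) b z + of_nat b * gauss_monomial c a (b
      - 1) z
      - of_real c * (gauss_monomial c (Suc a) b z + gauss_monomial c a (Suc b) z)" for z
  define gy where "gy z = \<i> * of_nat a * gauss_monomial c (a - 1) b z - \<i> * of_nat b
      * gauss_monomial c a (b - 1) z
      + of_real c * \<i> * (gauss_monomial c (Suc a) b z - gauss_monomial c a (Suc b) z)" for z
  \<comment> \<open>In this form each coordinate can be replaced by a complex variable
    \<open>t\<close>, so the rules for complex derivatives apply before restricting to the real
    line.\<close>
  have expand: "gauss_monomial c p q (Complex x y)
      = (of_real x + \<i> * of_real y) ^ p * (of_real x - \<i> * of_real y) ^ q
      * exp (- of_real c * (of_real x * of_real x + of_real y * of_real y))" for p q x y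
  proof -
    have "complex_of_real (exp (- c * (cmod (Complex x y))\<^sup>2)) =
        exp (- of_real c * (of_real x * of_real x + of_real y * of_real y))"
      unfolding cmod_power2 exp_of_real[symmetric] by (simp add: power2_eq_square)
    moreover have "Complex x y = of_real x + \<i> * of_real y" "cnj (Complex x y)
        = of_real x - \<i> * of_real y"
      by (simp_all add: complex_eq_iff)
    ultimately show ?thesis
      by (simp only: gauss_monomial_def)
  qed
  have int: "integrable lborel gx" "integrable lborel gy"
    unfolding gx_def gy_def using integrable_gauss_monomial[OF c] by auto
  have cont: "continuous_on UNIV (gauss_monomial c p q)" for p q
    unfolding gauss_monomial_def by (intro continuous_intros)
  have contC: "continuous_on UNIV (\<lambda>x. Complex x y)" "continuous_on UNIV (\<lambda>y. Complex x y)" for x y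
    unfolding Complex_eq by (intro continuous_intros)+
  have cont': "continuous_on UNIV (\<lambda>x. gauss_monomial c p q (Complex x y))" "continuous_on UNIV (\<lambda>y.
      gauss_monomial c p q (Complex x y))" for p q x y
    using continuous_on_compose2[OF cont contC(1)] continuous_on_compose2[OF cont contC(2)] by auto
  have "(LBINT x. gx (Complex x y)) = 0" for y
  proof (rule integral_derivative_eq_0[where F = "\<lambda>x. gauss_monomial c a b (Complex x y)"])
    show "((\<lambda>x. gauss_monomial c a b (Complex x y)) has_vector_derivative gx (Complex x y)) (at x)" for x
    proof -
      define e where "e t = exp (- of_real c * (t * t + of_real y * of_real y))" for t :: complex
      have e': "(e has_field_derivative - (2 * of_real c * t * e t)) (at t)" for t
        unfolding e_def by (auto intro!: derivative_eq_intros)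
      have "((\<lambda>t. (t + \<i> * of_real y) ^ a * (t - \<i> * of_real y) ^ b
          * e t) has_field_derivative gx (Complex x y)) (at (of_real x))"
        unfolding expand gx_def e_def[symmetric]
        by (rule derivative_eq_intros e' refl)+ (simp add: algebra_simps)
      from has_vector_derivative_real_field[OF this] show ?thesis
        by (simp add: expand e_def)
    qed
    show "continuous_on UNIV (\<lambda>x. gx (Complex x y))"
      unfolding gx_def by (intro continuous_intros cont')
  qed (intro gauss_monomial_tendsto_0[OF c] filterlim_Complex_at_infinity)+
  then have x0: "integral\<^sup>L lborel gx = 0"
    by (simp add: integral_complex_Im_Re[OF int(1)])
  have "(LBINT y. gy (Complex x y)) = 0" for x
  proof (rule integral_derivative_eq_0[where F = "\<lambda>y. gauss_monomial c a b (Complex x y)"])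
    show "((\<lambda>y. gauss_monomial c a b (Complex x y)) has_vector_derivative gy (Complex x y)) (at y)" for y
    proof -
      define e where "e t = exp (- of_real c * (of_real x * of_real x + t * t))" for t :: complex
      have e': "(e has_field_derivative - (2 * of_real c * t * e t)) (at t)" for t
        unfolding e_def by (auto intro!: derivative_eq_intros)
      have "((\<lambda>t. (of_real x + \<i> * t) ^ a * (of_real x - \<i> * t) ^ b
          * e t) has_field_derivative gy (Complex x y)) (at (of_real y))"
        unfolding expand gy_def e_def[symmetric]
        by (rule derivative_eq_intros e' refl)+ (simp add: algebra_simps)
      from has_vector_derivative_real_field[OF this] show ?thesis
        by (simp add: expand e_def)
    qed
    show "continuous_on UNIV (\<lambda>y. gy (Complex x y))"
      unfolding gy_def by (intro continuous_intros cont')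
  qed (intro gauss_monomial_tendsto_0[OF c] filterlim_Complex_at_infinity)+
  then have y0: "integral\<^sup>L lborel gy = 0"
    by (simp add: integral_complex_Re_Im[OF int(2)])
  \<comment> \<open>The combination is twice the derivative in \<open>cnj z\<close>, in which the
    terms with \<open>a\<close> and with \<open>Suc b\<close> cancel.\<close>
  have "gx z + \<i> * gy z = 2 * (of_nat b * gauss_monomial c a (b - 1) z - of_real c
      * gauss_monomial c (Suc a) b z)" for z
    by (simp add: gx_def gy_def algebra_simps)
  then have "(LBINT z. 2 * (of_nat b * gauss_monomial c a (b - 1) z - of_real c
      * gauss_monomial c (Suc a) b z)) = (LBINT z. gx z + \<i> * gy z)"
    by simp
  also have "\<dots> = 0"
    using int x0 y0 by simp
  finally have "of_nat b * integral\<^sup>L lborel (gauss_monomial c a (b - 1)) - of_real c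
      * integral\<^sup>L lborel (gauss_monomial c (Suc a) b) = 0"
    using integrable_gauss_monomial[OF c] by simp
  then show ?thesis
    using c by (simp add: nonzero_eq_divide_eq mult.commute)
qed

lemma gauss_monomial_moment:
  assumes c: "c > 0"
  shows "has_bochner_integral lborel (gauss_monomial c a b) (if a
      = b then of_real (pi / c * fact a / c ^ a) else 0)"
proof -
  have zero: "integral\<^sup>L lborel (gauss_monomial c 0 0) = of_real (pi / c)"
    using gaussian_integral_complex[OF c] unfolding gauss_monomial_def[abs_def]
    by (simp add: has_bochner_integral_iff)
  \<comment> \<open>Conjugation exchanges the exponents, and the reduction step applied to exponents
    \<open>Suc b\<close> and 0 carries the factor \<open>of_nat 0\<close>.\<close>
  have "gauss_monomial c 0 (Suc b) = (\<lambda>z. cnj (gauss_monomial c (Suc b) 0 z))" for b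
    by (simp add: gauss_monomial_def fun_eq_iff)
  then have zero_Suc: "integral\<^sup>L lborel (gauss_monomial c 0 (Suc b)) = 0" for b
    by (simp add: gauss_monomial_moment_step[OF c])
  have "integral\<^sup>L lborel (gauss_monomial c a b) = (if a
      = b then of_real (pi / c * fact a / c ^ a) else 0)"
  proof (induction a arbitrary: b)
    case 0
    then show ?case using zero zero_Suc by (cases b) auto
  next
    case (Suc a)
    show ?case by (cases b) (simp_all add: gauss_monomial_moment_step[OF c] Suc.IH mult_ac del:
        of_nat_Suc)
  qed
  then show ?thesis
    using integrable_gauss_monomial[OF c] by (simp add: has_bochner_integral_iff)
qed

text \<open>Induction on \<open>l\<close>: the recursion of \<open>ito_hermite\<close> either raises
  \<open>a\<close> or lowers \<open>k\<close>, hence \<open>a\<close>, \<open>b\<close> and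
  \<open>k\<close> are generalised. The base case is a plain Gaussian moment, in which
  \<open>a = b + k\<close> turns the coefficient into \<open>fact a\<close>.\<close>

lemma ito_hermite_moment:
  assumes \<eta>: "\<eta> > 0"
  defines "w \<equiv> (\<lambda>z. z / complex_of_real (sqrt \<eta>))"
  shows "has_bochner_integral lborel
      (\<lambda>z. of_real (exp (- (1 / \<eta>) * (cmod z)\<^sup>2)) * cnj (w z) ^ a * w z ^ b * ito_hermite l k (w z))
      (of_real (pi * \<eta> * (if a + l = b + k then fact k * real (a choose k) * fact b else 0)))"
proof (induction l arbitrary: a b k)
  case 0
  have s: "complex_of_real (sqrt \<eta>) * complex_of_real (sqrt \<eta>) = of_real \<eta>"
    using \<eta> by (simp flip: of_real_mult)
  have "of_real (exp (- (1 / \<eta>) * (cmod z)\<^sup>2)) * cnj (w z) ^ a * w z ^ b * ito_hermite 0 k (w z)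
      = 1 / of_real (sqrt \<eta>) ^ (a + b + k) * gauss_monomial (1 / \<eta>) (b + k) a z" for z
    by (simp add: w_def gauss_monomial_def power_divide power_add)
  moreover have "has_bochner_integral lborel
      (\<lambda>z. 1 / of_real (sqrt \<eta>) ^ (a + b + k) * gauss_monomial (1 / \<eta>) (b + k) a z)
      (1 / of_real (sqrt \<eta>) ^ (a + b + k) *
        (if b + k = a then of_real (pi / (1 / \<eta>) * fact (b + k) / (1 / \<eta>) ^ (b + k)) else 0))"
    using \<eta> by (intro has_bochner_integral_mult_right gauss_monomial_moment) auto
  moreover have "1 / of_real (sqrt \<eta>) ^ (a + b + k) *
        (if b + k = a then of_real (pi / (1 / \<eta>) * fact (b + k) / (1 / \<eta>) ^ (b + k)) else 0)
     = complex_of_real (pi * \<eta> * (if a + 0 = b + k then fact k * real (a choose k) * fact b else 0))"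
  proof (cases "a = b + k")
    case True
    have "fact k * fact b * (a choose k) = (fact a :: nat)"
      using binomial_fact_lemma[of k a] True by simp
    then have "real (fact k * fact b * (a choose k)) = real (fact a)"
      by (rule arg_cong)
    then have "fact k * real (a choose k) * fact b = fact a"
      by (simp add: mult_ac)
    moreover have "complex_of_real (sqrt \<eta>) ^ (a + b + k) = of_real \<eta> ^ a"
    proof -
      have "a + b + k = a + a" using True by simp
      then show ?thesis
        by (simp only: power_add power_mult_distrib[symmetric] s)
    qed
    ultimately show ?thesis
      using True \<eta> by (simp add: power_divide)
  qed auto
  ultimately show ?case by simp
next
  case (Suc l)
  let ?c = "\<lambda>a l b k. if a + l = b + k then fact k * real (a choose k) * fact b else (0::real)"
  have "has_bochner_integral lborel
      (\<lambda>z. of_real (exp (- (1 / \<eta>) * (cmod z)\<^sup>2)) * cnj (w z) ^ Suc a * w z ^ b * ito_hermite l k (w z)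
         - of_nat k * (of_real (exp (- (1 / \<eta>) * (cmod z)\<^sup>2)) * cnj (w z) ^ a * w z ^ b
             * ito_hermite l (k - 1) (w z)))
      (of_real (pi * \<eta> * ?c (Suc a) l b k) - of_nat k * of_real (pi * \<eta> * ?c a l b (k - 1)))"
    by (intro has_bochner_integral_diff has_bochner_integral_mult_right Suc.IH)
  moreover have "of_real (pi * \<eta> * ?c (Suc a) l b k) - of_nat k * of_real (pi * \<eta> * ?c a l b (k - 1))
      = complex_of_real (pi * \<eta> * (?c (Suc a) l b k - real k * ?c a l b (k - 1)))"
    by (simp add: algebra_simps)
  \<comment> \<open>Pascal's rule for \<open>Suc a choose k\<close>, multiplied by
    \<open>fact k\<close>.\<close>
  moreover have "?c (Suc a) l b k - real k * ?c a l b (k - 1) = ?c a (Suc l) b k"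
    by (cases k) (auto simp: algebra_simps)
  ultimately show ?case
    by (simp add: algebra_simps)
qed

section \<open>States and the heterodyne density\<close>

definition quad_form :: "nat \<Rightarrow> (nat \<Rightarrow> nat \<Rightarrow> complex) \<Rightarrow> (nat \<Rightarrow> complex) \<Rightarrow> complex" where
  "quad_form E \<rho> v = (\<Sum>k\<le>E. \<Sum>l\<le>E. cnj (v k) * \<rho> k l * v l)"

lemma quad_form_supported:
  assumes "S \<subseteq> {..E}" and "\<And>k. k \<notin> S \<Longrightarrow> v k = 0"
  shows "quad_form E \<rho> v = (\<Sum>k\<in>S. \<Sum>l\<in>S. cnj (v k) * \<rho> k l * v l)"
proof -
  have "quad_form E \<rho> v = (\<Sum>k\<in>S. \<Sum>l\<le>E. cnj (v k) * \<rho> k l * v l)"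
    unfolding quad_form_def using assms by (intro sum.mono_neutral_right) auto
  also have "\<dots> = (\<Sum>k\<in>S. \<Sum>l\<in>S. cnj (v k) * \<rho> k l * v l)"
    using assms by (intro sum.cong refl sum.mono_neutral_right) auto
  finally show ?thesis .
qed

text \<open>Testing a state on two basis vectors with a free coefficient \<open>u\<close> yields
  both Hermiticity and the bound on off-diagonal entries.\<close>

lemma quad_form_pair:
  fixes \<rho> :: "nat \<Rightarrow> nat \<Rightarrow> complex" and u :: complex
  assumes "a \<le> E" "b \<le> E" "a \<noteq> b"
  shows "quad_form E \<rho> (\<lambda>i. if i = a then 1 else if i = b then u else 0)
      = \<rho> a a + (cmod u)\<^sup>2 * \<rho> b b + u * \<rho> a b + cnj u * \<rho> b a"
  using quad_form_supported[of "{a, b}" E "\<lambda>i. if i = a then 1 else if i = b then u else 0" \<rho>] assms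
  by (simp add: algebra_simps complex_norm_square del: of_real_power)

lemma measurable_Qfun [measurable]: "Qfun E \<rho> \<in> borel_measurable borel"
  unfolding Qfun_def coh_def by (intro borel_measurable_continuous_onI continuous_intros) auto

lemma coh_product:
  "cnj (coh z a) * coh z b =
     of_real (exp (- (cmod z)\<^sup>2) / (sqrt (fact a) * sqrt (fact b))) * cnj z ^ a * z ^ b"
proof -
  have "exp (- (cmod z)\<^sup>2) = exp (- (cmod z)\<^sup>2 / 2) * exp (- (cmod z)\<^sup>2 / 2)"
    by (simp flip: exp_add)
  then show ?thesis
    by (simp add: coh_def)
qed

context
  fixes E \<rho>
  assumes state: "is_state E \<rho>"
begin

lemma quad_form_state: "Im (quad_form E \<rho> v) = 0" "Re (quad_form E \<rho> v) \<ge> 0"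
  using state by (auto simp: is_state_def quad_form_def)

lemma state_diag:
  assumes "a \<le> E"
  shows "Im (\<rho> a a) = 0" "Re (\<rho> a a) \<ge> 0"
proof -
  have "quad_form E \<rho> (\<lambda>i. if i = a then 1 else 0) = \<rho> a a"
    using quad_form_supported[of "{a}" E "\<lambda>i. if i = a then 1 else 0" \<rho>] assms by simp
  then show "Im (\<rho> a a) = 0" "Re (\<rho> a a) \<ge> 0"
    using quad_form_state[of "\<lambda>i. if i = a then 1 else 0"] by auto
qed

lemma state_trace: "(\<Sum>a\<le>E. Re (\<rho> a a)) = 1"
  using state by (simp add: is_state_def flip: Re_sum)

lemma state_hermitian:
  assumes "a \<le> E" "b \<le> E"
  shows "\<rho> b a = cnj (\<rho> a b)"
proof (cases "a = b")
  case True
  then show ?thesis using state_diag[of a] assms by (simp add: complex_eq_iff)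
next
  case False
  have "Im (\<rho> a a + (cmod u)\<^sup>2 * \<rho> b b + u * \<rho> a b + cnj u * \<rho> b a) = 0" for u
    unfolding quad_form_pair[OF assms False, symmetric] by (rule quad_form_state(1))
  \<comment> \<open>\<open>u = 1\<close> makes the imaginary parts opposite, and
    \<open>u = \<i>\<close> makes the real parts equal.\<close>
  from this[of 1] this[of \<i>] show ?thesis
    using state_diag[OF assms(1)] state_diag[OF assms(2)] by (simp add: complex_eq_iff)
qed

text \<open>The arithmetic mean is preferred to the geometric mean of Cauchy-Schwarz because it is
  linear in the diagonal and therefore sums up to the trace.\<close>

lemma state_offdiag_le:
  assumes "a \<le> E" "b \<le> E"
  shows "cmod (\<rho> a b) \<le> (Re (\<rho> a a) + Re (\<rho> b b)) / 2"
proof (cases "a = b")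
  case True
  then show ?thesis using state_diag[of a] assms by (simp add: cmod_eq_Re)
next
  case False
  show ?thesis
  proof (cases "\<rho> a b = 0")
    case True
    then show ?thesis using state_diag assms by simp
  next
    case nz: False
    \<comment> \<open>The phase that rotates \<open>\<rho> a b\<close> onto the negative real axis,
      where positivity is most restrictive.\<close>
    define u where "u = - cnj (sgn (\<rho> a b))"
    have u1: "cmod u = 1"
      using nz by (simp add: u_def norm_sgn)
    have "cnj (\<rho> a b) * \<rho> a b = of_real (cmod (\<rho> a b)) * of_real (cmod (\<rho> a b))"
      using complex_norm_square[of "\<rho> a b"] by (simp add: power2_eq_square mult.commute)
    then have u2: "u * \<rho> a b = - of_real (cmod (\<rho> a b))"
      using nz by (simp add: u_def sgn_eq)
    have "cnj u * \<rho> b a = cnj (u * \<rho> a b)"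
      using state_hermitian[OF assms] by simp
    then have "quad_form E \<rho> (\<lambda>i. if i = a then 1 else if i = b then u else 0)
        = \<rho> a a + \<rho> b b - of_real (2 * cmod (\<rho> a b))"
      using u1 u2 by (simp add: quad_form_pair[OF assms False])
    then show ?thesis
      using quad_form_state(2)[of "\<lambda>i. if i = a then 1 else if i = b then u else 0"] by simp
  qed
qed

lemma of_real_Qfun:
  "complex_of_real (Qfun E \<rho> z) = (\<Sum>a\<le>E. \<Sum>b\<le>E. cnj (coh z a) * \<rho> a b * coh z b) / of_real pi"
proof -
  have "complex_of_real (Re (quad_form E \<rho> (coh z))) = quad_form E \<rho> (coh z)"
    using quad_form_state(1)[of "coh z"] by (simp add: complex_eq_iff)
  then show ?thesis
    by (simp add: Qfun_def quad_form_def)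
qed

lemma Qfun_nonneg: "Qfun E \<rho> z \<ge> 0"
  using quad_form_state(2)[of "coh z"] by (simp add: Qfun_def quad_form_def)

text \<open>Angular integration kills every off-diagonal product of coherent coefficients; each
  diagonal product integrates to one, which leaves the trace.\<close>

lemma has_integral_Qfun: "has_bochner_integral lborel (Qfun E \<rho>) 1"
proof -
  have "cnj (coh z a) * \<rho> a b * coh z b / of_real pi
      = \<rho> a b / of_real (pi * (sqrt (fact a) * sqrt (fact b))) * gauss_monomial 1 b a z" for z a b
  proof -
    have "cnj (coh z a) * \<rho> a b * coh z b / of_real pi = \<rho> a b / of_real pi * (cnj (coh z a) * coh z b)"
      by simp
    then show ?thesis
      unfolding coh_product by (simp add: gauss_monomial_def)
  qed
  then have "(\<lambda>z. complex_of_real (Qfun E \<rho> z)) = (\<lambda>z. \<Sum>a\<le>E. \<Sum>b\<le>E.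
      \<rho> a b / of_real (pi * (sqrt (fact a) * sqrt (fact b))) * gauss_monomial 1 b a z)"
    by (simp add: of_real_Qfun sum_divide_distrib)
  moreover have "has_bochner_integral lborel (\<lambda>z. \<Sum>a\<le>E. \<Sum>b\<le>E.
      \<rho> a b / of_real (pi * (sqrt (fact a) * sqrt (fact b))) * gauss_monomial 1 b a z)
      (\<Sum>a\<le>E. \<Sum>b\<le>E. \<rho> a b / of_real (pi * (sqrt (fact a) * sqrt (fact b))) *
         (if b = a then of_real (pi / 1 * fact b / 1 ^ b) else 0))"
    by (intro has_bochner_integral_sum has_bochner_integral_mult_right gauss_monomial_moment) simp
  moreover have "(\<Sum>a\<le>E. \<Sum>b\<le>E. \<rho> a b / of_real (pi * (sqrt (fact a) * sqrt (fact b))) *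
         (if b = a then of_real (pi / 1 * fact b / 1 ^ b) else 0)) = (\<Sum>a\<le>E. \<rho> a a)"
  proof (intro sum.cong refl)
    fix a assume "a \<in> {..E}"
    moreover have s: "complex_of_real (sqrt (fact a)) * complex_of_real (sqrt (fact a)) = fact a"
      by (simp flip: of_real_mult)
    ultimately have "(\<Sum>b\<le>E. \<rho> a b / of_real (pi * (sqrt (fact a) * sqrt (fact b))) *
         (if b = a then of_real (pi / 1 * fact b / 1 ^ b) else 0))
       = (\<Sum>b\<le>E. if b = a then \<rho> a a else 0)"
      by (intro sum.cong) (auto simp: s)
    also have "\<dots> = \<rho> a a"
      using \<open>a \<in> {..E}\<close> by simp
    finally show "(\<Sum>b\<le>E. \<rho> a b / of_real (pi * (sqrt (fact a) * sqrt (fact b))) *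
         (if b = a then of_real (pi / 1 * fact b / 1 ^ b) else 0)) = \<rho> a a" .
  qed
  ultimately have "has_bochner_integral lborel (\<lambda>z. complex_of_real (Qfun E \<rho> z)) 1"
    using state by (simp add: is_state_def)
  from has_bochner_integral_Re[OF this] show ?thesis by simp
qed

lemma prob_space_Qfun: "prob_space (density lborel (\<lambda>z. ennreal (Qfun E \<rho> z)))"
proof
  have "(\<integral>\<^sup>+z. ennreal (Qfun E \<rho> z) \<partial>lborel) = 1"
    using has_integral_Qfun Qfun_nonneg
    by (subst nn_integral_eq_integral) (auto simp: has_bochner_integral_iff)
  then show "emeasure (density lborel (\<lambda>z. ennreal (Qfun E \<rho> z)))
      (space (density lborel (\<lambda>z. ennreal (Qfun E \<rho> z)))) = 1"
    by (simp add: emeasure_density)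
qed

end

section \<open>Bias of the estimator\<close>

lemma double_sum_delta:
  fixes g :: "nat \<Rightarrow> nat \<Rightarrow> 'a::comm_monoid_add"
  assumes "i \<le> E" "j \<le> E"
  shows "(\<Sum>a\<le>E. \<Sum>b\<le>E. if a = i \<and> b = j then g a b else 0) = g i j"
proof -
  have "(\<Sum>a\<le>E. \<Sum>b\<le>E. if a = i \<and> b = j then g a b else 0)
      = (\<Sum>a\<le>E. if a = i then (\<Sum>b\<le>E. if b = j then g a b else 0) else 0)"
    by (intro sum.cong refl) auto
  then show ?thesis
    using assms by simp
qed

lemma KA_ketbra:
  assumes "k \<le> E" "l \<le> E"
  shows "KA E (ketbra l k) = sqrt (real ((l + 1) * (k + 1)))"
proof -
  have "cmod (ketbra l k a b) * sqrt (real ((a + 1) * (b + 1))) = (if a = l \<and> b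
      = k then sqrt (real ((a + 1) * (b + 1))) else 0)" for a b
    by (simp add: ketbra_def)
  then show ?thesis
    unfolding KA_def using double_sum_delta[OF assms(2,1)] by (simp only:)
qed

lemma fA_ketbra:
  assumes "k \<le> E" "l \<le> E"
  shows "fA E (ketbra l k) z \<eta> =
    of_real (1 / \<eta> * exp ((1 - 1 / \<eta>) * (cmod z)\<^sup>2) * \<eta> powr (- (real l + real k) / 2)) * LL l k (z
        / of_real (sqrt \<eta>))"
proof -
  have "ketbra l k a b * of_real (\<eta> powr (- (real a + real b) / 2)) * LL a b (z / of_real (sqrt \<eta>))
      = (if a = l \<and> b = k then of_real (\<eta> powr (- (real a + real b) / 2)) * LL a b (z
          / of_real (sqrt \<eta>)) else 0)" for a b
    by (simp add: ketbra_def)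
  then have "fA E (ketbra l k) z \<eta> = of_real (1 / \<eta> * exp ((1 - 1 / \<eta>) * (cmod z)\<^sup>2)) *
      (of_real (\<eta> powr (- (real l + real k) / 2)) * LL l k (z / of_real (sqrt \<eta>)))"
    unfolding fA_def
    using double_sum_delta[OF assms(2,1), of "\<lambda>a b. of_real (\<eta> powr (- (real a + real b) / 2))
        * LL a b (z / of_real (sqrt \<eta>))"]
    by (simp only:)
  then show ?thesis
    by (simp only: of_real_mult mult.assoc)
qed

lemma cnj_fA_ketbra:
  assumes "k \<le> E" "l \<le> E"
  shows "cnj (fA E (ketbra l k) z \<eta>) = fA E (ketbra k l) z \<eta>"
  using assms by (simp add: fA_ketbra cnj_LL add.commute)

lemma measurable_fA [measurable]: "(\<lambda>z. fA E A z \<eta>) \<in> borel_measurable borel"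
proof -
  have "continuous_on UNIV (LL k l)" for k l
    unfolding LL_def by (intro continuous_intros)
  moreover have "continuous_on UNIV (\<lambda>z. z / complex_of_real (sqrt \<eta>))"
    by (rule linear_continuous_on[OF bounded_linear_divide])
  ultimately have "continuous_on UNIV (\<lambda>z. LL k l (z / complex_of_real (sqrt \<eta>)))" for k l
    by (rule continuous_on_compose2) auto
  then show ?thesis
    unfolding fA_def by (intro borel_measurable_continuous_onI continuous_intros)
qed

text \<open>The factor with which \<open>\<rho> a b\<close> enters the expected estimator, in the
  shape delivered by \<open>ito_hermite_moment\<close>. Its support is the diagonal through
  \<open>(k, l)\<close>; below \<open>a = k\<close> the binomial vanishes.\<close>

definition fock_weight :: "real \<Rightarrow> nat \<Rightarrow> nat \<Rightarrow> nat \<Rightarrow> nat \<Rightarrow> real" where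
  "fock_weight \<eta> k l a b =
     (if a + l = b + k
      then \<eta> powr ((real a + real b - real k - real l) / 2) * (fact k * real (a choose k) * fact b)
           / (sqrt (fact a) * sqrt (fact b) * (sqrt (fact k) * sqrt (fact l)))
      else 0)"

text \<open>In the variable \<open>w = z / sqrt \<eta>\<close> the Gaussian of the density and the
  exponential in \<open>fA\<close> combine to exactly the weight of
  \<open>ito_hermite_moment\<close>, which then evaluates each summand. \<open>C a b\<close> gathers
  the constants.\<close>

lemma expectation_fA_ketbra:
  assumes state: "is_state E \<rho>" and kl: "k \<le> E" "l \<le> E" and \<eta>: "\<eta> > 0"
  shows "integral\<^sup>L (density lborel (\<lambda>z. ennreal (Qfun E \<rho> z))) (\<lambda>z. fA E (ketbra l k) z \<eta>)
    = (\<Sum>a\<le>E. \<Sum>b\<le>E. \<rho> a b * of_real (fock_weight \<eta> k l a b))"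
proof -
  define w where "w z = z / complex_of_real (sqrt \<eta>)" for z
  define G where "G a b z = of_real (exp (- (1 / \<eta>) * (cmod z)\<^sup>2)) * cnj (w z) ^ a * w z ^ b
      * ito_hermite l k (w z)" for a b z
  define C where "C a b = \<eta> powr ((real a + real b - real k - real l) / 2) /
    (pi * \<eta> * (sqrt (fact a) * sqrt (fact b) * (sqrt (fact k) * sqrt (fact l))))" for a b
  have summand: "cnj (coh z a) * \<rho> a b * coh z b / of_real pi * fA E (ketbra l k) z \<eta>
      = \<rho> a b * of_real (C a b) * G a b z"
    for a b z
  proof -
    have z: "z = of_real (sqrt \<eta>) * w z"
      using \<eta> by (simp add: w_def)
    have zp: "cnj z ^ a * z ^ b = of_real (\<eta> powr ((real a + real b) / 2)) * (cnj (w z) ^ a * w z ^ b)"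
    proof -
      have "\<eta> powr ((real a + real b) / 2) = sqrt \<eta> ^ (a + b)"
        using \<eta> by (simp add: powr_half_sqrt[symmetric] powr_powr powr_realpow[symmetric])
      then show ?thesis
        by (subst (1 2) z) (simp add: power_mult_distrib power_add)
    qed
    have coh_product': "cnj (coh z a) * coh z b
        = of_real (exp (- (cmod z)\<^sup>2) / (sqrt (fact a) * sqrt (fact b))) *
        (of_real (\<eta> powr ((real a + real b) / 2)) * (cnj (w z) ^ a * w z ^ b))"
      by (simp only: coh_product mult.assoc zp)
    have e: "exp (- (cmod z)\<^sup>2) * exp ((1 - 1 / \<eta>) * (cmod z)\<^sup>2) = exp (- (1 / \<eta>) * (cmod z)\<^sup>2)"
      by (simp add: algebra_simps flip: exp_add)
    have p: "\<eta> powr ((real a + real b) / 2) * \<eta> powr (- (real l + real k) / 2)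
        = \<eta> powr ((real a + real b - real k - real l) / 2)"
    proof -
      have "(real a + real b) / 2 + - (real l + real k) / 2 = (real a + real b - real k - real l) / 2"
        by (simp add: field_simps)
      then show ?thesis
        by (simp only: powr_add[symmetric])
    qed
    have "cnj (coh z a) * \<rho> a b * coh z b / of_real pi * fA E (ketbra l k) z \<eta>
       = \<rho> a b * (cnj (coh z a) * coh z b) * fA E (ketbra l k) z \<eta> / of_real pi"
      by simp
    also have "\<dots> = \<rho> a b * of_real ((exp (- (cmod z)\<^sup>2) * exp ((1 - 1 / \<eta>) * (cmod z)\<^sup>2)) *
        (\<eta> powr ((real a + real b) / 2) * \<eta> powr (- (real l + real k) / 2)) /
        (pi * \<eta> * (sqrt (fact a) * sqrt (fact b) * (sqrt (fact k) * sqrt (fact l))))) *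
        (cnj (w z) ^ a * w z ^ b) * ito_hermite l k (w z)"
      unfolding coh_product' fA_ketbra[OF kl] w_def[symmetric] LL_eq_ito_hermite
      by (simp add: mult_ac)
    also have "\<dots> = \<rho> a b * of_real (C a b) * G a b z"
      unfolding e p C_def G_def by (simp add: mult_ac)
    finally show ?thesis .
  qed
  have "integral\<^sup>L (density lborel (\<lambda>z. ennreal (Qfun E \<rho> z))) (\<lambda>z. fA E (ketbra l k) z \<eta>)
      = (LBINT z. of_real (Qfun E \<rho> z) * fA E (ketbra l k) z \<eta>)"
    using Qfun_nonneg[OF state] measurable_Qfun by (subst integral_density) (auto simp:
        scaleR_conv_of_real)
  also have "(\<lambda>z. of_real (Qfun E \<rho> z) * fA E (ketbra l k) z \<eta>)
      = (\<lambda>z. \<Sum>a\<le>E. \<Sum>b\<le>E. \<rho> a b * of_real (C a b) * G a b z)"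
    by (simp only: of_real_Qfun[OF state] sum_divide_distrib sum_distrib_right summand)
  also have "integral\<^sup>L lborel \<dots> = (\<Sum>a\<le>E. \<Sum>b\<le>E. \<rho> a b * of_real (C a b) *
      of_real (pi * \<eta> * (if a + l = b + k then fact k * real (a choose k) * fact b else 0)))"
    unfolding G_def w_def
    by (intro has_bochner_integral_integral_eq has_bochner_integral_sum has_bochner_integral_mult_right
        ito_hermite_moment \<eta>)
  also have "\<dots> = (\<Sum>a\<le>E. \<Sum>b\<le>E. \<rho> a b * of_real (fock_weight \<eta> k l a b))"
  proof (intro sum.cong refl)
    fix a b
    have "C a b * (pi * \<eta> * (if a + l = b + k then fact k * real (a choose k) * fact b else 0))
        = fock_weight \<eta> k l a b"
      using \<eta> by (simp add: C_def fock_weight_def)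
    then show "\<rho> a b * of_real (C a b) * of_real (pi * \<eta> * (if a + l
        = b + k then fact k * real (a choose k) * fact b else 0))
       = \<rho> a b * of_real (fock_weight \<eta> k l a b)"
      by (simp only: mult.assoc of_real_mult[symmetric])
  qed
  finally show ?thesis .
qed

text \<open>Raising \<open>m\<close> by one multiplies the binomial by
  \<open>(k + m + 1) / (m + 1)\<close>, which is at most \<open>k + 1\<close>.\<close>

lemma binomial_le_Suc_power: "(k + m) choose m \<le> Suc k ^ m"
proof (induction m)
  case (Suc m)
  have "Suc m * ((k + Suc m) choose Suc m) = (k + Suc m) * ((k + m) choose m)"
    using Suc_times_binomial_eq[of "k + m" m] by (simp add: mult.commute)
  also have "\<dots> \<le> (Suc m * Suc k) * Suc k ^ m"
    by (intro mult_mono Suc.IH) simp_all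
  finally have "Suc m * ((k + Suc m) choose Suc m) \<le> Suc m * Suc k ^ Suc m"
    by (simp only: power_Suc mult.assoc)
  then show ?case
    by (simp only: mult_le_cancel1)
qed simp

lemma fock_weight_shift:
  assumes "\<eta> > 0"
  shows "fock_weight \<eta> k l (k + m) (l + m) = \<eta> ^ m * sqrt (real ((k + m) choose m) * real ((l
      + m) choose m))"
proof -
  have "(k + m choose k) = (k + m choose m)"
    using binomial_symmetric[of k "k + m"] by simp
  have b: "real ((i + m) choose m) = fact (i + m) / (fact m * fact i)" for i
    by (simp add: binomial_fact)
  have sq: "sqrt (fact i) * sqrt (fact i) = (fact i :: real)" for i by simp
  have "fact k * real ((k + m) choose k) * fact (l + m) / (sqrt (fact (k + m)) * sqrt (fact (l + m))
      * (sqrt (fact k) * sqrt (fact l)))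
     = (sqrt (fact (k + m)) * sqrt (fact (k + m))) * (sqrt (fact (l + m)) * sqrt (fact (l + m))) / fact m
         / (sqrt (fact (k + m)) * sqrt (fact (l + m)) * (sqrt (fact k) * sqrt (fact l)))"
    unfolding \<open>(k + m choose k) = (k + m choose m)\<close> b sq by simp
  also have "\<dots> = sqrt (fact (k + m)) * sqrt (fact (l + m)) / (fact m * (sqrt (fact k) * sqrt (fact l)))"
    by (simp add: field_simps)
  also have "\<dots> = sqrt (real ((k + m) choose m) * real ((l + m) choose m))"
    unfolding b by (simp add: real_sqrt_mult real_sqrt_divide)
  finally have "fact k * real ((k + m) choose k) * fact (l + m) / (sqrt (fact (k + m)) * sqrt (fact (l
      + m)) * (sqrt (fact k) * sqrt (fact l)))
     = sqrt (real ((k + m) choose m) * real ((l + m) choose m))" .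
  moreover have "\<eta> powr ((real (k + m) + real (l + m) - real k - real l) / 2) = \<eta> ^ m"
    using assms by (simp add: powr_realpow)
  ultimately show ?thesis
    by (simp only: fock_weight_def times_divide_eq_right[symmetric]) simp
qed

text \<open>On the diagonal, \<open>(a, b) \<noteq> (k, l)\<close> means a shift
  \<open>m \<ge> 1\<close>; then \<epsilon> \<le> 1 lets the power \<open>\<epsilon> ^ m\<close> be
  replaced by \<epsilon>.\<close>

lemma fock_weight_bound:
  assumes \<eta>: "\<eta> > 0" and \<epsilon>: "\<eta> * sqrt (real ((l + 1) * (k + 1))) \<le> \<epsilon>" "\<epsilon> \<le> 1"
    and ne: "(a, b) \<noteq> (k, l)"
  shows "\<bar>fock_weight \<eta> k l a b\<bar> \<le> (if a + l = b + k then \<epsilon> else 0)"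
proof -
  have "0 \<le> \<eta> * sqrt (real ((l + 1) * (k + 1)))"
    using \<eta> by (intro mult_nonneg_nonneg) simp_all
  then have \<epsilon>0: "0 \<le> \<epsilon>"
    using \<epsilon>(1) by (rule order_trans)
  show ?thesis
  proof (cases "a + l = b + k \<and> k \<le> a")
    case True
    define m where "m = a - k"
    have ab: "a = k + m" "b = l + m" and "m \<ge> 1"
      using True ne by (auto simp: m_def)
    have "fock_weight \<eta> k l a b = \<eta> ^ m * sqrt (real ((k + m) choose m) * real ((l + m) choose m))"
      unfolding ab by (rule fock_weight_shift[OF \<eta>])
    also have "\<dots> \<le> \<eta> ^ m * sqrt (real (Suc k ^ m) * real (Suc l ^ m))"
      using \<eta> by (intro mult_left_mono real_sqrt_le_mono mult_mono of_nat_mono binomial_le_Suc_power)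
          auto
    also have "\<dots> = (\<eta> * sqrt (real ((l + 1) * (k + 1)))) ^ m"
      by (simp only: of_nat_mult of_nat_power real_sqrt_mult real_sqrt_power power_mult_distrib
          Suc_eq_plus1 mult_ac)
    also have "\<dots> \<le> \<epsilon> ^ m"
      using \<eta> \<epsilon> by (intro power_mono) auto
    also have "\<epsilon> ^ m \<le> \<epsilon> ^ 1"
      using \<epsilon>(2) \<epsilon>0 \<open>m \<ge> 1\<close> by (intro power_decreasing)
    finally have "fock_weight \<eta> k l a b \<le> \<epsilon>" by simp
    moreover have "fock_weight \<eta> k l a b \<ge> 0"
      by (simp add: fock_weight_def)
    ultimately show ?thesis using True by simp
  next
    case False
    \<comment> \<open>Either the pair is off the diagonal or \<open>a < k\<close>, and in both cases
      the weight is zero.\<close>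
    then show ?thesis using \<epsilon>0 by (auto simp: fock_weight_def binomial_eq_0)
  qed
qed

lemma bias_fA_ketbra:
  assumes state: "is_state E \<rho>" and kl: "k \<le> E" "l \<le> E" and \<eta>: "\<eta> > 0"
    and \<epsilon>: "\<eta> * sqrt (real ((l + 1) * (k + 1))) \<le> \<epsilon>" "\<epsilon> \<le> 1"
  shows "cmod (\<rho> k l - integral\<^sup>L (density lborel (\<lambda>z. ennreal (Qfun E \<rho> z))) (\<lambda>z. fA E (ketbra l k) z
      \<eta>)) \<le> \<epsilon>"
proof -
  let ?W = "fock_weight \<eta> k l"
  have W1: "?W k l = 1"
    using fock_weight_shift[OF \<eta>, of k l 0] by simp
  have "0 \<le> \<eta> * sqrt (real ((l + 1) * (k + 1)))"
    using \<eta> by (intro mult_nonneg_nonneg) simp_all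
  then have \<epsilon>0: "0 \<le> \<epsilon>"
    using \<epsilon>(1) by (rule order_trans)
  have kl': "\<rho> k l = (\<Sum>a\<le>E. \<Sum>b\<le>E. if a = k \<and> b = l then \<rho> a b else 0)"
    by (simp only: double_sum_delta[OF kl])
  \<comment> \<open>The diagonal \<open>a + l = b + k\<close> meets each row at most once, and by
    \<open>one'\<close> each column at most once. So the averaged bounds on off-diagonal entries add
    up to no more than the trace.\<close>
  have one: "(\<Sum>b\<le>E. if a + l = b + k then x else 0) \<le> x" if "x \<ge> 0" for a and x :: real
  proof -
    have "(\<Sum>b\<le>E. if a + l = b + k then x else 0) = (\<Sum>b\<in>{b. b \<le> E \<and> a + l = b + k}. x)"
      by (simp add: sum.If_cases Int_def)
    also have "\<dots> \<le> (\<Sum>b\<in>{a + l - k}. x)"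
      using that by (intro sum_mono2) auto
    finally show ?thesis by simp
  qed
  have one': "(\<Sum>a\<le>E. if a + l = b + k then x else 0) \<le> x" if "x \<ge> 0" for b and x :: real
  proof -
    have "(\<Sum>a\<le>E. if a + l = b + k then x else 0) = (\<Sum>a\<in>{a. a \<le> E \<and> a + l = b + k}. x)"
      by (simp add: sum.If_cases Int_def)
    also have "\<dots> \<le> (\<Sum>a\<in>{b + k - l}. x)"
      using that by (intro sum_mono2) auto
    finally show ?thesis by simp
  qed
  have diff: "\<rho> k l - (\<Sum>a\<le>E. \<Sum>b\<le>E. \<rho> a b * of_real (?W a b))
      = (\<Sum>a\<le>E. \<Sum>b\<le>E. (if a = k \<and> b = l then \<rho> a b else 0) - \<rho> a b * of_real (?W a b))"
    by (subst kl') (simp add: sum_subtractf)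
  have "cmod (\<rho> k l - (\<Sum>a\<le>E. \<Sum>b\<le>E. \<rho> a b * of_real (?W a b))) \<le> (\<Sum>a\<le>E. \<Sum>b\<le>E. if a + l
      = b + k then \<epsilon> * ((Re (\<rho> a a) + Re (\<rho> b b)) / 2) else 0)"
    unfolding diff
  proof (intro sum_norm_le)
    fix a b assume ab: "a \<in> {..E}" "b \<in> {..E}"
    have nn: "0 \<le> \<epsilon> * ((Re (\<rho> a a) + Re (\<rho> b b)) / 2)"
      using \<epsilon>0 state_diag(2)[OF state] ab by simp
    show "cmod ((if a = k \<and> b = l then \<rho> a b else 0) - \<rho> a b * of_real (?W a b))
        \<le> (if a + l = b + k then \<epsilon> * ((Re (\<rho> a a) + Re (\<rho> b b)) / 2) else 0)"
    proof (cases "a = k \<and> b = l")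
      case True
      \<comment> \<open>The entry \<open>(k, l)\<close> has weight 1 and cancels against
        \<open>\<rho> k l\<close>.\<close>
      then show ?thesis using W1 nn by auto
    next
      case False
      have "cmod (\<rho> a b * of_real (?W a b)) = \<bar>?W a b\<bar> * cmod (\<rho> a b)"
        by (simp add: norm_mult)
      also have "\<dots> \<le> (if a + l = b + k then \<epsilon> else 0) * ((Re (\<rho> a a) + Re (\<rho> b b)) / 2)"
        using ab \<epsilon>0 by (intro mult_mono fock_weight_bound[OF \<eta> \<epsilon>] state_offdiag_le[OF state]) (use
            False in auto)
      finally show ?thesis
        using False by (auto split: if_splits)
    qed
  qed
  also have "\<dots> = \<epsilon> / 2 * ((\<Sum>a\<le>E. \<Sum>b\<le>E. if a + l = b + k then Re (\<rho> a a) else 0)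
      + (\<Sum>b\<le>E. \<Sum>a\<le>E. if a + l = b + k then Re (\<rho> b b) else 0))"
  proof -
    have swap: "(\<Sum>b\<le>E. \<Sum>a\<le>E. if a + l = b + k then Re (\<rho> b b) else 0)
        = (\<Sum>a\<le>E. \<Sum>b\<le>E. if a + l = b + k then Re (\<rho> b b) else 0)"
      by (rule sum.swap)
    show ?thesis
      unfolding swap sum.distrib[symmetric] sum_distrib_left
    proof (intro sum.cong refl)
      fix a b
      show "(if a + l = b + k then \<epsilon> * ((Re (\<rho> a a) + Re (\<rho> b b)) / 2) else 0) =
        \<epsilon> / 2 * ((if a + l = b + k then Re (\<rho> a a) else 0) + (if a + l = b + k then Re (\<rho> b b) else 0))"
        by (cases "a + l = b + k") simp_all
    qed
  qed
  also have "\<dots> \<le> \<epsilon> / 2 * ((\<Sum>a\<le>E. Re (\<rho> a a)) + (\<Sum>b\<le>E. Re (\<rho> b b)))"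
    using \<epsilon>0 state_diag(2)[OF state] by (intro mult_left_mono add_mono sum_mono one one') auto
  also have "\<dots> = \<epsilon>"
    using state_trace[OF state] by simp
  finally show ?thesis
    unfolding expectation_fA_ketbra[OF state kl \<eta>] .
qed

section \<open>Boundedness of the estimator\<close>

lemma cmod_LL_0:
  assumes "k = 0 \<or> l = 0"
  shows "(cmod (LL k l w))\<^sup>2 = ((cmod w)\<^sup>2) ^ max k l / fact (max k l)"
proof -
  have *: "(cmod (LL 0 l w))\<^sup>2 = ((cmod w)\<^sup>2) ^ l / fact l" for l
    by (simp add: LL_eq_ito_hermite norm_divide norm_power power_divide norm_mult flip: power_mult)
       (simp add: mult.commute)
  have "cmod (LL k 0 w) = cmod (LL 0 k w)"
    by (metis cnj_LL complex_mod_cnj)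
  then show ?thesis using assms * by auto
qed

text \<open>For \<open>k, l \<ge> 1\<close> the assumption forces \<eta> < 1/2, and the damping
  beats the growth \<open>exp (|w|^2 / 2)\<close>. Otherwise the polynomial is a monomial, and the
  weaker damping costs the factor \<open>2 ^ m\<close>.\<close>

lemma damped_LL_bound:
  assumes "0 < \<eta>" and "\<eta> * sqrt (real ((l + 1) * (k + 1))) < 1"
  shows "(exp (- (1 - \<eta>) * (cmod w)\<^sup>2) * cmod (LL l k w))\<^sup>2
     \<le> 2 ^ (max k l - min k l) * real (max k l choose min k l)"
proof (cases "k = 0 \<or> l = 0")
  case True
  define m where "m = max k l"
  define x where "x = (cmod w)\<^sup>2"
  have "x \<ge> 0" by (simp add: x_def)
  have m: "(l + 1) * (k + 1) = m + 1" "min k l = 0"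
    using True by (auto simp: m_def)
  have "(exp (- (1 - \<eta>) * x) * cmod (LL l k w))\<^sup>2 = exp (- 2 * (1 - \<eta>) * x) * (x ^ m / fact m)"
    using True by (auto simp: power_mult_distrib cmod_LL_0 m_def max.commute x_def simp flip: exp_double)
  also have "\<dots> \<le> 2 ^ m"
  proof (cases "m = 0")
    case True
    then have "\<eta> < 1" using assms m by simp
    then show ?thesis using True \<open>x \<ge> 0\<close> by (simp add: mult_nonpos_nonneg)
  next
    case False
    \<comment> \<open>For \<open>m \<ge> 1\<close> this gives \<eta> < 3/4, so after squaring the
      damping is at least \<open>exp (- x / 2)\<close>. For \<open>m = 0\<close> the polynomial is
      constant and \<eta> < 1 was enough.\<close>
    have "(4 / 3 :: real) \<le> sqrt 2"
      by (rule real_le_rsqrt) (simp add: power2_eq_square)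
    also have "sqrt 2 \<le> sqrt (real (m + 1))"
      using False by (intro real_sqrt_le_mono) simp
    finally have "\<eta> * (4 / 3) \<le> \<eta> * sqrt (real (m + 1))"
      using assms(1) by (intro mult_left_mono) simp_all
    then have "\<eta> * (4 / 3) < 1"
      using assms(2) unfolding m by (rule le_less_trans)
    then have "1 / 4 * x \<le> (1 - \<eta>) * x"
      using \<open>x \<ge> 0\<close> by (intro mult_right_mono) auto
    then have "- 2 * (1 - \<eta>) * x \<le> - (x / 2)"
      by (simp add: algebra_simps)
    then have "exp (- 2 * (1 - \<eta>) * x) * (x ^ m / fact m) \<le> exp (- (x / 2)) * (x ^ m / fact m)"
      using \<open>x \<ge> 0\<close> by (intro mult_right_mono) auto
    \<comment> \<open>Rescaling to \<open>x / 2\<close>, the rate of the available damping, is the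
      source of \<open>2 ^ m\<close>.\<close>
    also have "exp (- (x / 2)) * (x ^ m / fact m) = exp (- (x / 2)) * (2 ^ m * ((x / 2) ^ m / fact m))"
      by (simp add: power_divide)
    also have "exp (- (x / 2)) * (2 ^ m * ((x / 2) ^ m / fact m))
        \<le> exp (- (x / 2)) * (2 ^ m * exp (x / 2))"
      using \<open>x \<ge> 0\<close> by (intro mult_left_mono power_div_fact_le_exp) auto
    also have "\<dots> = 2 ^ m"
      by (simp add: exp_minus)
    finally show ?thesis .
  qed
  finally show ?thesis
    using m by (simp add: x_def m_def)
next
  case False
  have "sqrt (2 * 2) \<le> sqrt (real ((l + 1) * (k + 1)))"
  proof (intro real_sqrt_le_mono)
    have "2 * 2 \<le> (l + 1) * (k + 1)"
      using False by (intro mult_mono) auto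
    then have "real (2 * 2) \<le> real ((l + 1) * (k + 1))"
      by (rule of_nat_mono)
    then show "2 * 2 \<le> real ((l + 1) * (k + 1))"
      by simp
  qed
  then have "\<eta> * 2 \<le> \<eta> * sqrt (real ((l + 1) * (k + 1)))"
    using assms(1) by (intro mult_left_mono) simp_all
  then have "\<eta> * 2 < 1"
    using assms(2) by (rule le_less_trans)
  have "exp (- (1 - \<eta>) * (cmod w)\<^sup>2) * cmod (LL l k w)
      \<le> exp (- (1 - \<eta>) * (cmod w)\<^sup>2) * exp ((cmod w)\<^sup>2 / 2)"
    by (intro mult_left_mono cmod_LL_le_exp) simp
  also have "\<dots> = exp ((\<eta> - 1 / 2) * (cmod w)\<^sup>2)"
    by (simp add: algebra_simps flip: exp_add)
  also have "\<dots> \<le> 1"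
    using \<open>\<eta> * 2 < 1\<close> by (simp add: mult_nonpos_nonneg)
  finally have "(exp (- (1 - \<eta>) * (cmod w)\<^sup>2) * cmod (LL l k w))\<^sup>2 \<le> 1"
    by (intro power_le_one) auto
  also have "1 = (1::real) * 1" by simp
  also have "\<dots> \<le> 2 ^ (max k l - min k l) * real (max k l choose min k l)"
  proof (intro mult_mono)
    have "0 < (max k l choose min k l)" by (rule zero_less_binomial) auto
    then show "1 \<le> real (max k l choose min k l)" by linarith
  qed auto
  finally show ?thesis .
qed

lemma Ckl_pos: "Ckl k l > 0"
proof -
  have "0 < real ((k + 1) * (l + 1))" by (subst of_nat_0_less_iff) simp
  moreover have "0 < (max k l choose min k l)" by (rule zero_less_binomial) auto
  ultimately show ?thesis
    unfolding Ckl_def by (intro mult_pos_pos) (simp_all del: of_nat_mult)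
qed

text \<open>Squaring turns the prefactor into \<eta> to the power \<open>- (2 + k + l)\<close>. With
  \<eta> = \<epsilon> / K it splits into the power of \<epsilon> and the first factor of
  \<open>Ckl\<close>; the other factors come from \<open>damped_LL_bound\<close>.\<close>

lemma fA_ketbra_bound:
  assumes kl: "k \<le> E" "l \<le> E" and \<epsilon>: "\<epsilon> > 0" "\<epsilon> < 1"
  shows "(cmod (fA E (ketbra l k) z (\<epsilon> / KA E (ketbra l k))))\<^sup>2 \<le> Ckl k l / \<epsilon> ^ (2 + k + l)"
proof -
  define K where "K = sqrt (real ((l + 1) * (k + 1)))"
  define \<eta> where "\<eta> = \<epsilon> / K"
  define w where "w = z / complex_of_real (sqrt \<eta>)"
  have K: "K > 0"
    unfolding K_def real_sqrt_gt_0_iff of_nat_0_less_iff by simp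
  have \<eta>: "\<eta> > 0" "\<eta> * K < 1" using K \<epsilon> by (simp_all add: \<eta>_def)
  have z: "(cmod z)\<^sup>2 = \<eta> * (cmod w)\<^sup>2"
    using \<eta> by (simp add: w_def norm_divide power_divide)
  have ex: "(1 - 1 / \<eta>) * (cmod z)\<^sup>2 = - (1 - \<eta>) * (cmod w)\<^sup>2"
    using \<eta> by (simp add: z field_simps)
  have pw: "(1 / \<eta> * \<eta> powr (- (real l + real k) / 2))\<^sup>2 =
     real ((k + 1) * (l + 1)) powr (1 + (real k + real l) / 2) / \<epsilon> ^ (2 + k + l)"
  proof -
    have "1 / \<eta> * \<eta> powr (- (real l + real k) / 2) = \<eta> powr (- 1 - (real l + real k) / 2)"
    proof -
      have "1 / \<eta> = \<eta> powr (- 1)"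
        using \<eta> by (simp add: powr_minus_divide)
      moreover have "- 1 + - (real l + real k) / 2 = - 1 - (real l + real k) / 2"
        by (simp add: field_simps)
      ultimately show ?thesis
        by (simp only: powr_add[symmetric])
    qed
    moreover have "- 1 - (real l + real k) / 2 + (- 1 - (real l + real k) / 2) = - real (2 + k + l)"
      by (simp add: field_simps)
    ultimately have "(1 / \<eta> * \<eta> powr (- (real l + real k) / 2))\<^sup>2 = \<eta> powr (- real (2 + k + l))"
      by (simp only: powr_add[symmetric] power2_eq_square)
    also have "\<dots> = K powr real (2 + k + l) / \<epsilon> powr real (2 + k + l)"
    proof -
      have "(\<epsilon> / K) powr (- r) = K powr r / \<epsilon> powr r" for r
        using K \<epsilon> by (simp add: powr_minus_divide powr_divide)
      then show ?thesis
        by (simp only: \<eta>_def)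
    qed
    also have "\<epsilon> powr real (2 + k + l) = \<epsilon> ^ (2 + k + l)"
      using \<epsilon>(1) by (rule powr_realpow)
    also have "K powr real (2 + k + l) = real ((k + 1) * (l + 1)) powr (1 + (real k + real l) / 2)"
    proof -
      have "K = real ((k + 1) * (l + 1)) powr (1 / 2)"
        unfolding K_def by (simp add: powr_half_sqrt mult.commute)
      then show ?thesis
        by (simp add: powr_powr add_divide_distrib)
    qed
    finally show ?thesis .
  qed
  have "cmod (fA E (ketbra l k) z \<eta>)
      = (1 / \<eta> * \<eta> powr (- (real l + real k) / 2)) * (exp (- (1 - \<eta>) * (cmod w)\<^sup>2) * cmod (LL l k w))"
    unfolding fA_ketbra[OF kl] ex w_def[symmetric] norm_mult norm_of_real
    using \<eta> by (simp add: abs_mult)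
  then have "(cmod (fA E (ketbra l k) z \<eta>))\<^sup>2
      = real ((k + 1) * (l + 1)) powr (1 + (real k + real l) / 2) / \<epsilon> ^ (2 + k + l)
        * (exp (- (1 - \<eta>) * (cmod w)\<^sup>2) * cmod (LL l k w))\<^sup>2"
    by (simp only: power_mult_distrib[of "1 / \<eta> * _"] pw)
  also have "\<dots> \<le> real ((k + 1) * (l + 1)) powr (1 + (real k + real l) / 2) / \<epsilon> ^ (2 + k + l)
        * (2 ^ (max k l - min k l) * real (max k l choose min k l))"
    using \<eta> \<epsilon> by (intro mult_left_mono damped_LL_bound) (auto simp: K_def)
  also have "\<dots> = Ckl k l / \<epsilon> ^ (2 + k + l)"
    by (simp add: Ckl_def)
  finally show ?thesis
    using KA_ketbra[OF kl] by (simp add: \<eta>_def K_def)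
qed

section \<open>Concentration of the estimator\<close>

text \<open>Independence means that the joint law is the product of the marginals; here the joint
  map is the identity on the product space.\<close>

lemma indep_vars_PiM_coordinates:
  assumes P: "prob_space P" and "I \<noteq> {}"
  shows "prob_space.indep_vars (PiM I (\<lambda>_. P)) (\<lambda>_. P) (\<lambda>i \<alpha>. \<alpha> i) I"
proof -
  interpret S: prob_space "PiM I (\<lambda>_. P)"
    using P by (intro prob_space_PiM)
  have "distr (PiM I (\<lambda>_. P)) (PiM I (\<lambda>_. P)) (\<lambda>\<alpha>. \<lambda>i\<in>I. \<alpha> i)
      = distr (PiM I (\<lambda>_. P)) (PiM I (\<lambda>_. P)) (\<lambda>\<alpha>. \<alpha>)"
    by (intro distr_cong) (auto simp: space_PiM PiE_def extensional_restrict)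
  also have "\<dots> = PiM I (\<lambda>_. P)"
    by simp
  also have "\<dots> = PiM I (\<lambda>i. distr (PiM I (\<lambda>_. P)) P (\<lambda>\<alpha>. \<alpha> i))"
    using P by (intro PiM_cong refl) (simp add: distr_PiM_component[where M = "\<lambda>_. P"])
  finally show ?thesis
    using assms(2) by (subst S.indep_vars_iff_distr_eq_PiM') auto
qed

lemma hoeffding_PiM:
  fixes g :: "'a \<Rightarrow> real"
  assumes P: "prob_space P" and g [measurable]: "g \<in> borel_measurable P"
    and bound: "\<And>x. \<bar>g x\<bar> \<le> M" and M: "M > 0" and n: "n \<ge> (1::nat)" and t: "t \<ge> 0"
  shows "measure (PiM {..<n} (\<lambda>_. P))
      {\<alpha> \<in> space (PiM {..<n} (\<lambda>_. P)). \<bar>(\<Sum>i<n. g (\<alpha> i)) / real n - integral\<^sup>L P g\<bar> \<ge> t}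
    \<le> 2 * exp (- (real n * t\<^sup>2) / (2 * M\<^sup>2))"
proof -
  let ?S = "PiM {..<n} (\<lambda>_. P)"
  interpret S: prob_space ?S
    using P by (intro prob_space_PiM)
  have I: "{..<n} \<noteq> {}" using n by (auto simp: lessThan_empty_iff)
  have "S.indep_vars (\<lambda>_. borel) (\<lambda>i \<alpha>. g (\<alpha> i)) {..<n}"
    using indep_vars_PiM_coordinates[OF P I] by (rule S.indep_vars_compose2) simp
  then interpret H: Hoeffding_ineq ?S "{..<n}" "\<lambda>i \<alpha>. g (\<alpha> i)" "\<lambda>_.
      - M" "\<lambda>_. M" "\<Sum>i<n. S.expectation (\<lambda>\<alpha>. g (\<alpha> i))"
    using bound by unfold_locales (auto simp: abs_le_iff minus_le_iff)
  have "S.expectation (\<lambda>\<alpha>. g (\<alpha> i)) = integral\<^sup>L P g" if "i < n" for i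
  proof -
    have "integral\<^sup>L P g = integral\<^sup>L (distr ?S P (\<lambda>\<alpha>. \<alpha> i)) g"
      using P that by (simp add: distr_PiM_component[where M = "\<lambda>_. P"])
    also have "\<dots> = S.expectation (\<lambda>\<alpha>. g (\<alpha> i))"
      using that by (intro integral_distr) auto
    finally show ?thesis by simp
  qed
  then have \<mu>: "(\<Sum>i<n. S.expectation (\<lambda>\<alpha>. g (\<alpha> i))) = real n * integral\<^sup>L P g"
    by simp
  have "\<bar>(\<Sum>i<n. g (\<alpha> i)) / real n - integral\<^sup>L P g\<bar> \<ge> t \<longleftrightarrow>
      \<bar>(\<Sum>i<n. g (\<alpha> i)) - real n * integral\<^sup>L P g\<bar> \<ge> real n * t" for \<alpha>
  proof -
    have "(\<Sum>i<n. g (\<alpha> i)) - real n * integral\<^sup>L P g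
        = real n * ((\<Sum>i<n. g (\<alpha> i)) / real n - integral\<^sup>L P g)"
      using n by (simp add: right_diff_distrib)
    then show ?thesis
      using n by (simp add: abs_mult)
  qed
  moreover have "measure ?S {\<alpha> \<in> space ?S. \<bar>(\<Sum>i<n. g (\<alpha> i)) - real n * integral\<^sup>L P g\<bar> \<ge> real n * t}
      \<le> 2 * exp (- 2 * (real n * t)\<^sup>2 / (\<Sum>i<n. (M - - M)\<^sup>2))"
    using H.Hoeffding_ineq_abs_ge[of "real n * t"] t n M unfolding \<mu> by simp
  \<comment> \<open>Each variable ranges over an interval of width \<open>2 * M\<close>, so the
    denominator is \<open>4 * n * M\<^sup>2\<close>.\<close>
  moreover have "- 2 * (real n * t)\<^sup>2 / (\<Sum>i<n. (M - - M)\<^sup>2) = - (real n * t\<^sup>2) / (2 * M\<^sup>2)"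
    using n M by (simp add: power2_eq_square field_simps)
  ultimately show ?thesis by simp
qed

text \<open>If both coordinates deviate by less than \<open>t / sqrt 2\<close>, the modulus deviates
  by less than \<open>t\<close>. A real \<open>f\<close> keeps this level, so that both bounds share
  one exponent, and saves the imaginary event.\<close>

lemma
  fixes f :: "'a \<Rightarrow> complex"
  assumes P: "prob_space P" and f [measurable]: "f \<in> borel_measurable P"
    and bound: "\<And>x. cmod (f x) \<le> M" and M: "M > 0" and n: "n \<ge> (1::nat)" and t: "t > 0"
  defines "S \<equiv> PiM {..<n} (\<lambda>_. P)"
  defines "B \<equiv> {\<alpha> \<in> space S. cmod ((\<Sum>i<n. f (\<alpha> i)) / of_nat n - integral\<^sup>L P f) > t}"
  shows hoeffding_complex: "measure S B \<le> 4 * exp (- (real n * t\<^sup>2) / (4 * M\<^sup>2))"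
    and hoeffding_complex_real: "(\<And>x. Im (f x) = 0) \<Longrightarrow> measure S B
        \<le> 2 * exp (- (real n * t\<^sup>2) / (4 * M\<^sup>2))"
proof -
  interpret P: prob_space P by (rule P)
  interpret S: prob_space S
    unfolding S_def using P by (intro prob_space_PiM)
  define s where "s = t / sqrt 2"
  have s: "s > 0" "s\<^sup>2 = t\<^sup>2 / 2"
    using t by (simp_all add: s_def power_divide)
  have int: "integrable P f"
    using bound by (intro P.integrable_const_bound[of _ M]) auto
  define R where "R = {\<alpha> \<in> space S. \<bar>(\<Sum>i<n. Re (f (\<alpha> i))) / real n - integral\<^sup>L P (\<lambda>x. Re (f x))\<bar> \<ge> s}"
  define J where "J = {\<alpha> \<in> space S. \<bar>(\<Sum>i<n. Im (f (\<alpha> i))) / real n - integral\<^sup>L P (\<lambda>x. Im (f x))\<bar> \<ge> s}"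
  have ex: "- (real n * s\<^sup>2) / (2 * M\<^sup>2) = - (real n * t\<^sup>2) / (4 * M\<^sup>2)"
    by (simp add: s)
  have R: "measure S R \<le> 2 * exp (- (real n * t\<^sup>2) / (4 * M\<^sup>2))"
    unfolding R_def S_def ex[symmetric]
    using P M n s order_trans[OF abs_Re_le_cmod bound] by (intro hoeffding_PiM) auto
  have J: "measure S J \<le> 2 * exp (- (real n * t\<^sup>2) / (4 * M\<^sup>2))"
    unfolding J_def S_def ex[symmetric]
    using P M n s order_trans[OF abs_Im_le_cmod bound] by (intro hoeffding_PiM) auto
  have [measurable]: "(\<lambda>\<alpha>. f (\<alpha> i)) \<in> borel_measurable S" if "i < n" for i
    unfolding S_def
    by (rule measurable_compose[OF measurable_component_singleton]) (use that in auto)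
  have meas: "R \<in> sets S" "J \<in> sets S"
    unfolding R_def J_def by measurable
  have sub: "B \<subseteq> R \<union> J"
  proof
    fix \<alpha> assume "\<alpha> \<in> B"
    then have \<alpha>: "\<alpha> \<in> space S" and gt: "cmod ((\<Sum>i<n. f (\<alpha> i)) / of_nat n - integral\<^sup>L P f) > t"
      by (auto simp: B_def)
    define d where "d = (\<Sum>i<n. f (\<alpha> i)) / of_nat n - integral\<^sup>L P f"
    have d: "Re d = (\<Sum>i<n. Re (f (\<alpha> i))) / real n - integral\<^sup>L P (\<lambda>x. Re (f x))"
      "Im d = (\<Sum>i<n. Im (f (\<alpha> i))) / real n - integral\<^sup>L P (\<lambda>x. Im (f x))"
      using int by (simp_all add: d_def)
    show "\<alpha> \<in> R \<union> J"
    proof (rule ccontr)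
      assume "\<alpha> \<notin> R \<union> J"
      then have "\<bar>Re d\<bar> < s" "\<bar>Im d\<bar> < s"
        using \<alpha> by (auto simp: R_def J_def d)
      then have "(Re d)\<^sup>2 < s\<^sup>2" "(Im d)\<^sup>2 < s\<^sup>2"
        by (metis abs_ge_zero power2_abs power_strict_mono zero_less_numeral)+
      then have "(cmod d)\<^sup>2 < t\<^sup>2"
        by (simp add: cmod_power2 s)
      then have "cmod d < t"
        by (rule power2_less_imp_less) (use t in simp)
      then show False using gt by (simp add: d_def)
    qed
  qed
  have "measure S B \<le> measure S (R \<union> J)"
    using meas by (intro S.finite_measure_mono sub) auto
  also have "\<dots> \<le> measure S R + measure S J"
    using meas by (intro measure_Un_le)
  finally show "measure S B \<le> 4 * exp (- (real n * t\<^sup>2) / (4 * M\<^sup>2))"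
    using R J by linarith
  assume "\<And>x. Im (f x) = 0"
  then have "J = {}" using s by (simp add: J_def)
  then have "measure S B \<le> measure S R"
    using meas sub by (intro S.finite_measure_mono) auto
  then show "measure S B \<le> 2 * exp (- (real n * t\<^sup>2) / (4 * M\<^sup>2))"
    using R by linarith
qed

section \<open>Deviation of a single matrix entry and the union bound\<close>

lemma Im_fA_ketbra_diag:
  assumes "k \<le> E"
  shows "Im (fA E (ketbra k k) z \<eta>) = 0"
  using arg_cong[OF cnj_fA_ketbra[OF assms assms, of z \<eta>], of Im] by simp

lemma cnj_rho_est:
  assumes "k \<le> E" "l \<le> E"
  shows "cnj (rho_est E n \<epsilon> k l \<alpha>) = rho_est E n \<epsilon> l k \<alpha>"
  using assms by (simp add: rho_est_def cnj_fA_ketbra KA_ketbra mult.commute)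

text \<open>The bias uses up at most \<epsilon>, so an error above
  \<open>\<epsilon> + \<epsilon>'\<close> forces a statistical fluctuation above
  \<open>\<epsilon>'\<close>.\<close>

lemma rho_est_deviation:
  fixes E n k l :: nat and \<rho> :: "nat \<Rightarrow> nat \<Rightarrow> complex" and \<epsilon> \<epsilon>' :: real
  assumes \<epsilon>: "0 < \<epsilon>" "\<epsilon> < 1" and \<epsilon>': "0 < \<epsilon>'" and n: "n \<ge> 1" and state: "is_state E \<rho>"
    and kl: "k \<le> E" "l \<le> E"
  defines "S \<equiv> sample_measure E \<rho> n"
  defines "B \<equiv> {\<alpha> \<in> space S. cmod (\<rho> k l - rho_est E n \<epsilon> k l \<alpha>) > \<epsilon> + \<epsilon>'}"
  shows "measure S B \<le> (if k = l then 2 else 4) * exp (- (real n * \<epsilon> ^ (2 + k + l) * \<epsilon>'\<^sup>2) / (4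
      * Ckl k l))"
proof -
  define P where "P = density lborel (\<lambda>z. ennreal (Qfun E \<rho> z))"
  define f where "f z = fA E (ketbra l k) z (\<epsilon> / KA E (ketbra l k))" for z
  define M where "M = sqrt (Ckl k l / \<epsilon> ^ (2 + k + l))"
  have S: "S = PiM {..<n} (\<lambda>_. P)"
    by (simp add: S_def sample_measure_def P_def)
  have P: "prob_space P"
    unfolding P_def by (rule prob_space_Qfun[OF state])
  have f [measurable]: "f \<in> borel_measurable P"
    unfolding f_def P_def by simp
  have C: "Ckl k l / \<epsilon> ^ (2 + k + l) > 0"
    using Ckl_pos[of k l] \<epsilon> by simp
  have M: "M > 0" "M\<^sup>2 = Ckl k l / \<epsilon> ^ (2 + k + l)"
    using C by (simp_all add: M_def)
  have bound: "cmod (f z) \<le> M" for z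
    unfolding M_def f_def by (rule real_le_rsqrt) (rule fA_ketbra_bound[OF kl \<epsilon>])
  have K: "KA E (ketbra l k) > 0"
    unfolding KA_ketbra[OF kl] real_sqrt_gt_0_iff of_nat_0_less_iff by simp
  have bias: "cmod (\<rho> k l - integral\<^sup>L P f) \<le> \<epsilon>"
    \<comment> \<open>For \<eta> = \<epsilon> / K the product of \<eta> and K is exactly
      \<epsilon>.\<close>
    unfolding P_def f_def using \<epsilon> K KA_ketbra[OF kl]
    by (intro bias_fA_ketbra[OF state kl]) auto
  let ?B = "{\<alpha> \<in> space (PiM {..<n} (\<lambda>_. P)). cmod ((\<Sum>i<n. f (\<alpha> i)) / of_nat n - integral\<^sup>L P f) > \<epsilon>'}"
  have "B \<subseteq> ?B"
  proof
    fix \<alpha> assume \<alpha>: "\<alpha> \<in> B"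
    have "cmod (\<rho> k l - rho_est E n \<epsilon> k l \<alpha>)
        \<le> cmod (\<rho> k l - integral\<^sup>L P f) + cmod (rho_est E n \<epsilon> k l \<alpha> - integral\<^sup>L P f)"
      by (metis norm_triangle_ineq4 diff_diff_eq2 diff_add_cancel)
    then have "cmod (rho_est E n \<epsilon> k l \<alpha> - integral\<^sup>L P f) > \<epsilon>'"
      using \<alpha> bias by (simp add: B_def)
    moreover have "rho_est E n \<epsilon> k l \<alpha> = (\<Sum>i<n. f (\<alpha> i)) / of_nat n"
      by (simp add: rho_est_def f_def)
    ultimately show "\<alpha> \<in> ?B"
      using \<alpha> by (simp add: B_def S)
  qed
  interpret S: prob_space S
    unfolding S using P by (intro prob_space_PiM)
  have meas: "?B \<in> sets S"
    unfolding S by measurable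
  have le: "measure S B \<le> measure S ?B"
    by (rule S.finite_measure_mono[OF \<open>B \<subseteq> ?B\<close> meas])
  have ex: "- (real n * \<epsilon>'\<^sup>2) / (4 * M\<^sup>2) = - (real n * \<epsilon> ^ (2 + k + l) * \<epsilon>'\<^sup>2) / (4 * Ckl k l)"
    using C \<epsilon> unfolding M(2) by (simp add: mult_ac)
  note h = P f bound M(1) n \<epsilon>'
  show ?thesis
  proof (cases "k = l")
    case True
    have "measure S ?B \<le> 2 * exp (- (real n * \<epsilon>'\<^sup>2) / (4 * M\<^sup>2))"
      unfolding S by (rule hoeffding_complex_real[OF h]) (use True Im_fA_ketbra_diag[OF kl(1)] in \<open>simp
          add: f_def\<close>)
    then show ?thesis
      using le True unfolding ex by simp
  next
    case False
    have "measure S ?B \<le> 4 * exp (- (real n * \<epsilon>'\<^sup>2) / (4 * M\<^sup>2))"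
      unfolding S by (rule hoeffding_complex[OF h])
    then show ?thesis
      using le False unfolding ex by simp
  qed
qed

lemma measurable_rho_est:
  "rho_est E n \<epsilon> k l \<in> borel_measurable (sample_measure E \<rho> n)"
proof -
  have "(\<lambda>\<alpha>. fA E A (\<alpha> i) \<eta>) \<in> borel_measurable (sample_measure E \<rho> n)" if "i < n" for i A \<eta>
    unfolding sample_measure_def
    by (rule measurable_compose[OF measurable_component_singleton]) (use that in auto)
  then show ?thesis
    unfolding rho_est_def[abs_def] by (intro borel_measurable_divide borel_measurable_sum) auto
qed

text \<open>The last assumption expresses the range 0 < \<eta> < 1 prescribed for the second
  argument of \<open>fA\<close>, for every \<eta> that the estimators use.\<close>

theorem theorem2:
  fixes \<epsilon> \<epsilon>' :: real and n E :: nat and \<rho> :: "nat \<Rightarrow> nat \<Rightarrow> complex"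
  assumes "\<epsilon> > 0" and "\<epsilon>' > 0" and "n \<ge> 1"
    and "is_state E \<rho>"
    and "\<forall>k\<le>E. \<forall>l\<le>E. \<epsilon> / KA E (ketbra l k) < 1"
  shows "measure (sample_measure E \<rho> n)
           {\<alpha> \<in> space (sample_measure E \<rho> n).
              \<forall>k\<le>E. \<forall>l\<le>E. cmod (\<rho> k l - rho_est E n \<epsilon> k l \<alpha>) \<le> \<epsilon> + \<epsilon>'}
         > 1 - 4 * (\<Sum>l\<le>E. \<Sum>k\<le>l.
                 exp (- (real n * \<epsilon> ^ (2 + k + l) * \<epsilon>'\<^sup>2) / (4 * Ckl k l)))"
proof -
  define S where "S = sample_measure E \<rho> n"
  define e where "e k l = exp (- (real n * \<epsilon> ^ (2 + k + l) * \<epsilon>'\<^sup>2) / (4 * Ckl k l))" for k l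
  define bad where "bad k l = {\<alpha> \<in> space S. cmod (\<rho> k l - rho_est E n \<epsilon> k l \<alpha>) > \<epsilon> + \<epsilon>'}" for k l
  define good where "good = {\<alpha> \<in> space S. \<forall>k\<le>E. \<forall>l\<le>E. cmod (\<rho> k l - rho_est E n \<epsilon> k l \<alpha>) \<le> \<epsilon> + \<epsilon>'}"
  \<comment> \<open>The pair \<open>k = l = 0\<close> has \<open>KA = 1\<close>.\<close>
  have "\<epsilon> < 1"
    using assms(5) KA_ketbra[of 0 E 0] by force
  interpret S: prob_space S
    unfolding S_def sample_measure_def
    using prob_space_Qfun[OF assms(4)] by (intro prob_space_PiM)
  have [measurable]: "rho_est E n \<epsilon> k l \<in> borel_measurable S" for k l
    unfolding S_def by (rule measurable_rho_est)
  have bad_sets: "bad k l \<in> sets S" for k l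
    unfolding bad_def by measurable
  \<comment> \<open>State and estimator are both Hermitian, so pairs \<open>k \<le> l\<close> are
    enough in the union bound.\<close>
  have bad_sym: "bad l k = bad k l" if "k \<le> E" "l \<le> E" for k l
  proof -
    have "\<rho> l k - rho_est E n \<epsilon> l k \<alpha> = cnj (\<rho> k l - rho_est E n \<epsilon> k l \<alpha>)" for \<alpha>
      using that state_hermitian[OF assms(4) that] cnj_rho_est[OF that] by simp
    then show ?thesis
      unfolding bad_def by (simp only: complex_mod_cnj)
  qed
  have compl: "space S - good = (\<Union>l\<le>E. \<Union>k\<le>l. bad k l)"
  proof
    show "space S - good \<subseteq> (\<Union>l\<le>E. \<Union>k\<le>l. bad k l)"
    proof
      fix \<alpha> assume "\<alpha> \<in> space S - good"
      then obtain k l where kl: "k \<le> E" "l \<le> E" "\<alpha> \<in> bad k l"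
        by (auto simp: good_def bad_def not_le)
      show "\<alpha> \<in> (\<Union>l\<le>E. \<Union>k\<le>l. bad k l)"
      proof (cases "k \<le> l")
        case True
        then show ?thesis using kl by auto
      next
        case False
        then have "\<alpha> \<in> bad l k" "l \<le> k" using kl bad_sym by auto
        then show ?thesis using kl by auto
      qed
    qed
    show "(\<Union>l\<le>E. \<Union>k\<le>l. bad k l) \<subseteq> space S - good"
      by (auto simp: good_def bad_def not_le intro: order_trans)
        (meson linorder_not_le order_trans)
  qed
  have "good \<in> sets S"
  proof -
    have "good \<subseteq> space S"
      by (auto simp: good_def)
    then have "good = space S - (\<Union>l\<le>E. \<Union>k\<le>l. bad k l)"
      unfolding compl[symmetric] by (simp add: double_diff)
    then show ?thesis
      using bad_sets by auto
  qed
  have dev: "measure S (bad k l) \<le> (if k = l then 2 else 4) * e k l" if "k \<le> l" "l \<le> E" for k l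
    unfolding bad_def S_def e_def
    using rho_est_deviation[OF assms(1) \<open>\<epsilon> < 1\<close> assms(2,3,4)] that by simp
  have "1 - measure S good = measure S (\<Union>l\<le>E. \<Union>k\<le>l. bad k l)"
    using S.prob_compl[OF \<open>good \<in> sets S\<close>] compl by simp
  also have "\<dots> \<le> (\<Sum>l\<le>E. measure S (\<Union>k\<le>l. bad k l))"
    using bad_sets by (intro S.finite_measure_subadditive_finite) auto
  also have "\<dots> \<le> (\<Sum>l\<le>E. \<Sum>k\<le>l. measure S (bad k l))"
    using bad_sets by (intro sum_mono S.finite_measure_subadditive_finite) auto
  \<comment> \<open>Strictness comes from the diagonal pair in each row: its bound
    \<open>2 * e l l\<close> is below the allotted \<open>4 * e l l\<close> because \<open>e\<close>
    is positive.\<close>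
  also have "\<dots> < (\<Sum>l\<le>E. \<Sum>k\<le>l. 4 * e k l)"
  proof (rule sum_strict_mono)
    fix l assume l: "l \<in> {..E}"
    have pos: "e k l > 0" for k l by (simp add: e_def)
    show "(\<Sum>k\<le>l. measure S (bad k l)) < (\<Sum>k\<le>l. 4 * e k l)"
    proof (rule sum_strict_mono_ex1)
      show "\<forall>k\<in>{..l}. measure S (bad k l) \<le> 4 * e k l"
      proof
        fix k assume "k \<in> {..l}"
        then show "measure S (bad k l) \<le> 4 * e k l"
          using dev[of k l] l pos[of k l] by (auto split: if_splits)
      qed
      show "\<exists>k\<in>{..l}. measure S (bad k l) < 4 * e k l"
        using dev[of l l] l pos[of l l] by (intro bexI[of _ l]) auto
    qed simp
  qed auto
  also have "\<dots> = 4 * (\<Sum>l\<le>E. \<Sum>k\<le>l. e k l)"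
    by (simp add: sum_distrib_left)
  finally have "measure S good > 1 - 4 * (\<Sum>l\<le>E. \<Sum>k\<le>l. e k l)"
    by linarith
  then show ?thesis
    by (simp only: S_def good_def e_def)
qed

end
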